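(* Let $n\in\mathbb N$, $n\ge2$. Then $\mathcal F^{\mathbb R}_{n+2,n}$ is connected.
   Context: $\mathcal F^{\mathbb R}_{k,n}$ is the space of spherical tight frames of $k$ vectors in $\mathbb R^n$: all ordered lists $(f_1,\dots,f_k)$ of unit vectors in $\mathbb R^n$ for which there is $B>0$ with $\sum_{i=1}^k|\langle v,f_i\rangle|^2=B\|v\|^2$ for all $v\in\mathbb R^n$, with the relative topology from $(\mathbb R^n)^k$. *)

theory Defs
  imports "HOL-Analysis.Analysis"
begin

text \<open>The index type \<open>'k\<close> plays the role of \<open>{1,...,k}\<close>, so an element \<open>f\<close> of
  \<open>real ^ 'n ^ 'k\<close> is the list of vectors \<open>f $ i\<close>. The topology of
  \<open>real ^ 'n ^ 'k\<close> is the product topology of \<open>(\<real>\<^sup>n)\<^sup>k\<close>.\<close>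

definition spherical_tight_frames :: "(real ^ 'n ^ 'k) set" where
  "spherical_tight_frames =
     {f. (\<forall>i. norm (f $ i) = 1) \<and>
         (\<exists>B>0. \<forall>v. (\<Sum>i\<in>UNIV. \<bar>v \<bullet> f $ i\<bar>\<^sup>2) = B * (norm v)\<^sup>2)}"

end

theory Submission imports Defs begin

text \<open>
  Write \<open>n = CARD('n)\<close> and \<open>k = n + 2\<close>. A unit-norm tight frame of \<open>k\<close> vectors, viewed as an
  \<open>n \<times> k\<close> matrix with the frame vectors as columns, has orthogonal rows of equal length
  \<open>sqrt (k / n)\<close>. Dividing by this length and completing the rows to an orthonormal basis of
  \<open>\<real>\<^sup>k\<close> by two further rows \<open>u\<close>, \<open>v\<close> gives a rotation matrix, and the columns of the frame are
  unit vectors exactly if \<open>u\<^sub>i\<^sup>2 + v\<^sub>i\<^sup>2 = 2 / k\<close> for all \<open>i\<close>. So the frames are the continuous image of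
  the set of rotations whose rows \<open>p\<close> and \<open>q\<close> are balanced in this sense
  (\<open>spherical_tight_frames_eq_image\<close>); the sign of the determinant can be prescribed, because
  \<open>v\<close> may be replaced by \<open>- v\<close>.

  Put \<open>z\<^sub>i = sqrt (k / 2) (u\<^sub>i + \<i> v\<^sub>i)\<close>. Then \<open>u\<close>, \<open>v\<close> are orthonormal and balanced exactly if all
  \<open>z\<^sub>i\<close> have modulus 1 and \<open>\<Sum> z\<^sub>i\<^sup>2 = 0\<close>. The set of balanced rotations thus maps onto the space of
  such tuples \<open>z\<close>; it is compact and the fibres are cosets of a rotation group, hence connected
  (\<open>connected_component_rotations_fixing_rows\<close>). It remains to see that the space of the \<open>z\<close> is
  connected when \<open>k \<ge> 4\<close> (\<open>connected_polygon_lifts\<close>).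

  The squares \<open>z\<^sub>i\<^sup>2\<close> are the edges of a closed polygon with unit sides, and each edge carries a choice
  of square root. A subset of the edges with sum zero can be rotated rigidly. The key lemma
  \<open>exists_antipodal_pair\<close> says that within a set \<open>S\<close> of at least four edges with sum zero any two
  chosen edges can be moved into opposite position, all edges outside \<open>S\<close> being fixed: at a point of
  the component that minimises the length of the sum of the two edges, this sum must vanish,
  since otherwise it could be shortened at the expense of a pair of edges whose sum points in
  the other direction (\<open>shorten_pair_sum\<close>). By rotating antipodal pairs one changes the sign of a
  single \<open>z\<^sub>i\<close> (\<open>flip_single_connected\<close>) and exchanges two coordinates (\<open>swap_coords_connected\<close>)
  without leaving the component. Two arbitrary points are then joined by splitting off antipodal
  pairs, two edges at a time, until no edge or three edges are left
  (\<open>connected_component_agree_off\<close>).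
\<close>

section \<open>Rotation matrices with prescribed rows\<close>

lemma orthogonal_matrix_iff_inner_rows:
  fixes A :: "real^'k^'k"
  shows "orthogonal_matrix A \<longleftrightarrow> (\<forall>i j. A$i \<bullet> A$j = (if i = j then 1 else 0))"
  unfolding orthogonal_matrix_orthonormal_rows
  by (auto simp: row_def orthogonal_def norm_eq_1)

text \<open>The reflection in the hyperplane orthogonal to \<open>c\<close>; it is the identity if \<open>c = 0\<close>.\<close>

definition reflection :: "'a::real_inner \<Rightarrow> 'a \<Rightarrow> 'a" where
  "reflection c x = x - (2 * (x \<bullet> c) / (c \<bullet> c)) *\<^sub>R c"

lemma inner_reflection [simp]: "reflection c x \<bullet> reflection c y = x \<bullet> y"
  by (cases "c = 0") (simp_all add: reflection_def algebra_simps inner_commute field_simps)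

lemma reflection_orthogonal: "x \<bullet> c = 0 \<Longrightarrow> reflection c x = x"
  by (simp add: reflection_def)

lemma reflection_self [simp]: "reflection c c = - c"
  by (cases "c = 0") (simp_all add: reflection_def scaleR_2)

lemma reflection_minus [simp]: "reflection c (- x) = - reflection c x"
  by (simp add: reflection_def)

lemma reflection_involution [simp]: "reflection c (reflection c x) = x"
  by (cases "c = 0") (simp_all add: reflection_def algebra_simps)

lemma reflection_diff:
  assumes "norm x = norm y"
  shows "reflection (x - y) x = y"
proof (cases "x = y")
  case False
  have "x \<bullet> x = y \<bullet> y"
    using assms by (simp add: norm_eq)
  then have "2 * (x \<bullet> (x - y)) = (x - y) \<bullet> (x - y)"
    by (simp add: inner_diff_left inner_diff_right inner_commute)
  moreover have "(x - y) \<bullet> (x - y) \<noteq> 0"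
    using False by simp
  ultimately have "2 * (x \<bullet> (x - y)) / ((x - y) \<bullet> (x - y)) = 1"
    by simp
  then show ?thesis
    unfolding reflection_def by (simp only: scaleR_one) simp
qed (simp add: reflection_def)

lemma orthogonal_matrix_reflection:
  fixes M :: "real^'k^'k"
  assumes "orthogonal_matrix M"
  shows "orthogonal_matrix (\<chi> j. reflection c (M$j))"
  using assms by (simp add: orthogonal_matrix_iff_inner_rows)

lemma det_negate_row:
  fixes M N :: "real^'k^'k"
  assumes "N$i = - (M$i)" "\<And>j. j \<noteq> i \<Longrightarrow> N$j = M$j"
  shows "det N = - det M"
proof -
  have N: "N = (\<chi> j. if j = i then (-1) *s (M$i) else M$j)"
    using assms by (auto simp: vec_eq_iff)
  have M: "M = (\<chi> j. if j = i then (M$i) else M$j)"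
    by (auto simp: vec_eq_iff)
  show ?thesis
    using det_row_mul[of i "-1" "\<lambda>_. M$i" "\<lambda>j. M$j"] N M by simp
qed

text \<open>An orthonormal family of row vectors is completed to an orthogonal matrix by moving the rows
  of the identity matrix into place one after the other; the reflection that moves the next row
  fixes those already placed.\<close>

lemma orthonormal_rows_extend:
  fixes w :: "'k::finite \<Rightarrow> real^'k"
  assumes "\<And>i j. i \<in> S \<Longrightarrow> j \<in> S \<Longrightarrow> w i \<bullet> w j = (if i = j then 1 else 0)"
  obtains M where "orthogonal_matrix M" "\<And>j. j \<in> S \<Longrightarrow> M$j = w j"
proof -
  have "finite S" by simp
  then have "\<exists>M::real^'k^'k. orthogonal_matrix M \<and> (\<forall>j\<in>S. M$j = w j)"
    using assms
  proof (induction S)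
    case empty
    show ?case using orthogonal_matrix_id by blast
  next
    case (insert i S)
    then obtain M :: "real^'k^'k" where M: "orthogonal_matrix M" "\<forall>j\<in>S. M$j = w j"
      by (metis insertCI)
    define N where "N = (\<chi> j. reflection (M$i - w i) (M$j))"
    have inner: "M$a \<bullet> M$b = (if a = b then 1 else 0)" for a b
      using M(1) by (simp add: orthogonal_matrix_iff_inner_rows)
    have "N$i = w i"
      using inner[of i i] insert.prems[of i i]
      by (simp add: N_def reflection_diff norm_eq)
    moreover have "N$j = w j" if "j \<in> S" for j
    proof -
      have "j \<noteq> i" using that insert.hyps by blast
      then have "M$j \<bullet> (M$i - w i) = 0"
        using inner[of j i] insert.prems[of j i] that M(2) by (simp add: inner_diff_right)
      then show ?thesis
        using that M(2) by (simp add: N_def reflection_orthogonal)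
    qed
    ultimately show ?case
      using orthogonal_matrix_reflection[OF M(1)] N_def by blast
  qed
  then show ?thesis using that by blast
qed

lemma rotation_rows_extend:
  fixes w :: "'k::finite \<Rightarrow> real^'k"
  assumes w: "\<And>i j. i \<in> S \<Longrightarrow> j \<in> S \<Longrightarrow> w i \<bullet> w j = (if i = j then 1 else 0)"
    and r: "r \<notin> S"
  obtains M where "rotation_matrix M" "\<And>j. j \<in> S \<Longrightarrow> M$j = w j"
proof -
  obtain M where M: "orthogonal_matrix M" "\<And>j. j \<in> S \<Longrightarrow> M$j = w j"
    using orthonormal_rows_extend[of S w] w by blast
  show ?thesis
  proof (cases "det M = 1")
    case True
    then show ?thesis using M that by (auto simp: rotation_matrix_def)
  next
    case False
    then have "det M = -1"
      using M(1) det_orthogonal_matrix by blast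
    define N where "N = (\<chi> j. if j = r then - (M$r) else M$j)"
    have "orthogonal_matrix N"
      using M(1) by (simp add: orthogonal_matrix_iff_inner_rows N_def)
    moreover have "det N = 1"
      using det_negate_row[of N r M] \<open>det M = -1\<close> by (simp add: N_def)
    moreover have "N$j = w j" if "j \<in> S" for j
      using that r M(2) by (auto simp: N_def)
    ultimately show ?thesis using that by (auto simp: rotation_matrix_def)
  qed
qed

lemma continuous_on_det:
  fixes M :: "'a::topological_space \<Rightarrow> real^'k^'k"
  assumes "continuous_on T M"
  shows "continuous_on T (\<lambda>t. det (M t))"
  unfolding det_def by (intro continuous_intros assms)

text \<open>Let \<open>R\<^sub>c\<close> be the reflection along \<open>c\<close>, and \<open>x\<close> the \<open>i\<close>-th row of \<open>M\<close>. Applying first \<open>R\<^sub>x\<close> and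
  then \<open>R\<^sub>c\<close> to the rows of \<open>M\<close>, while \<open>c\<close> runs along the segment from \<open>x\<close> to \<open>d\<close>, gives a path of
  rotations that starts at \<open>M\<close>. The assumption on \<open>d \<bullet> x\<close> keeps the segment away from 0.\<close>

lemma rotation_two_reflections:
  fixes M :: "real^'k^'k"
  assumes M: "rotation_matrix M" and d: "d \<noteq> 0" "d \<bullet> M$i \<ge> 0"
    and fixrows: "\<And>j. j \<in> S \<Longrightarrow> j \<noteq> i \<and> M$j \<bullet> d = 0"
  defines "N \<equiv> \<chi> j. reflection d (reflection (M$i) (M$j))"
  shows "connected_component {A. rotation_matrix A \<and> (\<forall>j\<in>S. A$j = M$j)} M N"
    (is "connected_component ?R M N")
proof -
  let ?c = "\<lambda>t. (1 - t) *\<^sub>R M$i + t *\<^sub>R d"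
  define P where "P t = (\<chi> j. reflection (?c t) (reflection (M$i) (M$j)))" for t
  have inner: "M$a \<bullet> M$b = (if a = b then 1 else 0)" for a b
    using M by (simp add: orthogonal_matrix_iff_inner_rows rotation_matrix_def)
  have nz: "?c t \<noteq> 0" if "t \<in> {0..1}" for t
  proof (cases "t = 1")
    case False
    have "?c t \<bullet> M$i = (1 - t) + t * (d \<bullet> M$i)"
      using inner[of i i] by (simp add: inner_add_left)
    also have "\<dots> > 0"
      using that d(2) False by (simp add: add_pos_nonneg)
    finally show ?thesis by auto
  qed (use d in auto)
  have cont: "continuous_on {0..1} P"
    unfolding P_def reflection_def
    by (intro continuous_intros ballI) (use nz in auto)
  have start: "P 0 = M"
    by (simp add: P_def)
  have orth: "orthogonal_matrix (P t)" for t
    using M by (simp add: P_def orthogonal_matrix_iff_inner_rows rotation_matrix_def)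
  \<comment> \<open>the determinant is continuous with values in \<open>{1, -1}\<close>\<close>
  have det: "det (P t) = 1" if "t \<in> {0..1}" for t
  proof -
    have "connected ((\<lambda>t. det (P t)) ` {0..1})"
      by (intro connected_continuous_image continuous_on_det cont) simp
    moreover have "finite ((\<lambda>t. det (P t)) ` {0..1})"
      by (rule finite_subset[of _ "{1,-1}"]) (use orth det_orthogonal_matrix in blast, simp)
    ultimately have "\<exists>x. (\<lambda>t. det (P t)) ` {0..1} = {x}"
      by (subst (asm) connected_finite_iff_sing) auto
    then obtain x where x: "(\<lambda>t. det (P t)) ` {0..1} = {x}" ..
    have "det (P t) \<in> {x}"
      using that unfolding x[symmetric] by (rule imageI)
    moreover have "det (P 0) \<in> {x}"
      unfolding x[symmetric] by (rule imageI) simp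
    ultimately have "det (P t) = det (P 0)" by simp
    also have "\<dots> = 1"
      unfolding start using M by (simp add: rotation_matrix_def)
    finally show ?thesis .
  qed
  have rows: "P t $ j = M$j" if "j \<in> S" for j t
    using fixrows[OF that] inner[of j i]
    by (simp add: P_def reflection_orthogonal inner_add_right)
  have "connected (P ` {0..1})"
    by (intro connected_continuous_image cont) simp
  moreover have "P ` {0..1} \<subseteq> ?R"
    using orth det rows by (auto simp: rotation_matrix_def)
  moreover have "M \<in> P ` {0..1}"
    using start by (metis atLeastAtMost_iff image_eqI order_refl zero_le_one)
  moreover have "N \<in> P ` {0..1}"
    by (rule image_eqI[of _ _ 1]) (auto simp: N_def P_def)
  ultimately show ?thesis
    unfolding connected_component_def by blast
qed

text \<open>The rows outside \<open>S\<close> are moved one after the other from their place in \<open>M\<close> to their place in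
  \<open>M'\<close>. To send \<open>- x\<close> to \<open>y\<close>, where \<open>x\<close> and \<open>y\<close> are the \<open>i\<close>-th rows of \<open>M\<close> and \<open>M'\<close>, one reflects
  along \<open>x + y\<close>, and if \<open>y = - x\<close> along any other free row; there is such a row, since otherwise
  the determinants of \<open>M\<close> and \<open>M'\<close> would differ in sign.\<close>

lemma connected_component_rotations_fixing_rows:
  fixes M M' :: "real^'k^'k"
  assumes "rotation_matrix M" "rotation_matrix M'" "\<And>j. j \<in> S \<Longrightarrow> M'$j = M$j"
  shows "connected_component {A. rotation_matrix A \<and> (\<forall>j\<in>S. A$j = M$j)} M M'"
  using assms
proof (induction "card (- S)" arbitrary: S M)
  case 0
  then have "S = UNIV" by auto
  then have "M' = M" using "0.prems" by (auto simp: vec_eq_iff)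
  then show ?case using "0.prems" by simp
next
  case (Suc m)
  have "- S \<noteq> {}"
    using Suc.hyps(2) by (metis card.empty nat.simps(3))
  then obtain i where i: "i \<notin> S" by blast
  have inner: "M$a \<bullet> M$b = (if a = b then 1 else 0)" 
      "M'$a \<bullet> M'$b = (if a = b then 1 else 0)" for a b
    using Suc.prems by (simp_all add: orthogonal_matrix_iff_inner_rows rotation_matrix_def)
  have inner': "M$a \<bullet> M'$i = 0" if "a \<in> S" for a
    using that i inner(2)[of a i] Suc.prems(3)[of a] by auto
  have "\<exists>d. d \<noteq> 0 \<and> d \<bullet> M$i \<ge> 0 \<and> (\<forall>j\<in>S. M$j \<bullet> d = 0) \<and> reflection d (- (M$i)) = M'$i"
  proof (cases "M'$i = - (M$i)")
    case False
    let ?d = "M$i + M'$i"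
    have "norm (M$i) = 1" "norm (M'$i) = 1"
      using inner[of i i] by (simp_all add: norm_eq_1)
    then have "- (M'$i \<bullet> M$i) \<le> 1"
      using Cauchy_Schwarz_ineq2[of "M'$i" "M$i"] by simp
    then have "?d \<bullet> M$i \<ge> 0"
      using inner(1)[of i i] by (simp add: inner_add_left)
    moreover have "?d \<noteq> 0"
      using False by (metis add.inverse_inverse eq_neg_iff_add_eq_0)
    moreover have "\<forall>j\<in>S. M$j \<bullet> ?d = 0"
      using i inner(1)[of _ i] inner' by (auto simp: inner_add_right)
    moreover have "reflection ?d (- (M$i)) = M'$i"
      using reflection_diff[of "M$i" "- (M'$i)"] \<open>norm (M$i) = 1\<close> \<open>norm (M'$i) = 1\<close> by simp
    ultimately show ?thesis by blast
  next
    case True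
    have "\<exists>l. l \<noteq> i \<and> l \<notin> S"
    proof (rule ccontr)
      assume "\<nexists>l. l \<noteq> i \<and> l \<notin> S"
      then have "det M' = - det M"
        using True Suc.prems(3) by (intro det_negate_row[of _ i]) auto
      then show False using Suc.prems by (simp add: rotation_matrix_def)
    qed
    then obtain l where l: "l \<noteq> i" "l \<notin> S" by blast
    have "M$l \<noteq> 0" using inner(1)[of l l] by auto
    moreover have "\<forall>j\<in>S. M$j \<bullet> M$l = 0" using l inner(1) by auto
    moreover have "reflection (M$l) (- (M$i)) = M'$i"
      using True inner(1)[of i l] l by (simp add: reflection_orthogonal)
    moreover have "M$l \<bullet> M$i \<ge> 0" using inner(1)[of l i] by simp
    ultimately show ?thesis by blast
  qed
  then obtain d where d: "d \<noteq> 0" "d \<bullet> M$i \<ge> 0" "\<And>j. j \<in> S \<Longrightarrow> M$j \<bullet> d = 0"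
    "reflection d (- (M$i)) = M'$i" by blast
  define N where "N = (\<chi> j. reflection d (reflection (M$i) (M$j)))"
  have MN: "connected_component {A. rotation_matrix A \<and> (\<forall>j\<in>S. A$j = M$j)} M N"
    unfolding N_def using d i Suc.prems(1) by (intro rotation_two_reflections) auto
  then have N: "rotation_matrix N" "\<And>j. j \<in> S \<Longrightarrow> N$j = M$j"
    using connected_component_in[OF MN] by simp_all
  have Ni: "N$i = M'$i"
    using d(4) by (simp add: N_def)
  have "card (- insert i S) = m"
  proof -
    have "- insert i S = - S - {i}" by auto
    then show ?thesis using Suc.hyps(2) i by (simp add: card_Diff_singleton)
  qed
  then have "connected_component {A. rotation_matrix A \<and> (\<forall>j\<in>insert i S. A$j = N$j)} N M'"
  proof (intro Suc.hyps(1))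
    show "M'$j = N$j" if "j \<in> insert i S" for j
      using that Ni N(2) Suc.prems(3) by (metis insertE)
  qed (use N(1) Suc.prems(2) in simp_all)
  then have "connected_component {A. rotation_matrix A \<and> (\<forall>j\<in>S. A$j = M$j)} N M'"
    by (rule connected_component_of_subset) (use N in auto)
  then show ?case
    using MN connected_component_trans by blast
qed

section \<open>Polygons with unit sides and square roots of their edges\<close>

lemma norm_eq_1_if_power2: "(norm x)\<^sup>2 = 1 \<Longrightarrow> norm x = 1"
  by (metis norm_ge_zero one_power2 power2_eq_imp_eq zero_le_one)

text \<open>Tuples of unit complex numbers whose squares sum to zero. The squares are the edge vectors of
  a closed polygon with unit sides, so a point of this space is such a polygon together with a
  choice of a square root of every edge.\<close>

definition polygon_lifts :: "(complex^'k) set" where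
  "polygon_lifts = {z. (\<forall>j. norm (z$j) = 1) \<and> (\<Sum>j\<in>UNIV. (z$j)\<^sup>2) = 0}"

lemma compact_polygon_lifts: "compact (polygon_lifts :: (complex^'k) set)"
proof -
  have "polygon_lifts =
      (\<Inter>j. {z::complex^'k. norm (z$j) = 1}) \<inter> {z. (\<Sum>j\<in>UNIV. (z$j)\<^sup>2) = 0}"
    by (auto simp: polygon_lifts_def)
  moreover have "closed \<dots>"
    by (intro closed_Int closed_INT ballI closed_Collect_eq continuous_intros)
  moreover have "bounded (polygon_lifts :: (complex^'k) set)"
    unfolding bounded_iff
  proof (intro exI ballI)
    fix z :: "complex^'k" assume "z \<in> polygon_lifts"
    then have "norm (z$j) = 1" for j by (simp add: polygon_lifts_def)
    then have "(\<Sum>j\<in>UNIV. norm (z$j)) = real CARD('k)" by simp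
    then show "norm z \<le> real CARD('k)"
      using L2_set_le_sum[of UNIV "\<lambda>j. norm (z$j)"] by (simp add: norm_vec_def)
  qed
  ultimately show ?thesis by (simp add: compact_eq_bounded_closed)
qed

lemma connected_component_image:
  assumes "connected_component S x y" "continuous_on S g" "\<And>x. x \<in> S \<Longrightarrow> g x \<in> S"
  shows "connected_component S (g x) (g y)"
proof -
  obtain C where C: "connected C" "C \<subseteq> S" "x \<in> C" "y \<in> C"
    using assms(1) unfolding connected_component_def by blast
  have "connected (g ` C)"
    using C assms(2) by (meson connected_continuous_image continuous_on_subset)
  then show ?thesis
    unfolding connected_component_def using C assms(3) by (intro exI[of _ "g ` C"]) auto
qed

lemma sum_modified_part:
  fixes f g :: "'k::finite \<Rightarrow> 'a::ab_group_add"
  assumes "\<And>l. l \<notin> S \<Longrightarrow> f l = g l" "sum f S = sum g S"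
  shows "sum f UNIV = sum g UNIV"
proof -
  have "sum h UNIV = sum h S + sum h (- S)" for h :: "'k \<Rightarrow> 'a"
    by (metis Compl_disjoint Compl_partition finite sum.union_disjoint)
  moreover have "sum f (- S) = sum g (- S)"
    using assms(1) by (intro sum.cong) auto
  ultimately show ?thesis using assms(2) by simp
qed

lemma sum_agreeing_part:
  fixes f g :: "'k::finite \<Rightarrow> 'a::ab_group_add"
  assumes "\<And>l. l \<notin> S \<Longrightarrow> f l = g l" "sum f UNIV = sum g UNIV"
  shows "sum f S = sum g S"
proof -
  have "sum h UNIV = sum h S + sum h (- S)" for h :: "'k \<Rightarrow> 'a"
    by (metis Compl_disjoint Compl_partition finite sum.union_disjoint)
  moreover have "sum f (- S) = sum g (- S)"
    using assms(1) by (intro sum.cong) auto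
  ultimately show ?thesis using assms(2) by (metis add_right_cancel)
qed

text \<open>Multiplying the coordinates in \<open>S\<close> by \<open>c\<close> rotates the corresponding edges of the polygon by \<open>c\<^sup>2\<close>.\<close>

definition rotate_part :: "'k set \<Rightarrow> complex \<Rightarrow> complex^'k \<Rightarrow> complex^'k" where
  "rotate_part S c z = (\<chi> l. if l \<in> S then c * z$l else z$l)"

lemma rotate_part_nth: "rotate_part S c z $ l = (if l \<in> S then c * z$l else z$l)"
  by (simp add: rotate_part_def)

lemma rotate_part_connected:
  fixes z :: "complex^'k"
  assumes z: "z \<in> polygon_lifts" and S: "(\<Sum>j\<in>S. (z$j)\<^sup>2) = 0" and c: "norm c = 1"
  shows "connected_component polygon_lifts z (rotate_part S c z)"
proof -
  have "rotate_part S c z \<in> polygon_lifts" if "norm c = 1" for c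
  proof -
    have "(\<Sum>j\<in>UNIV. (rotate_part S c z$j)\<^sup>2) = (\<Sum>j\<in>UNIV. (z$j)\<^sup>2)"
    proof (rule sum_modified_part[of S])
      have "(\<Sum>j\<in>S. (rotate_part S c z$j)\<^sup>2) = c\<^sup>2 * (\<Sum>j\<in>S. (z$j)\<^sup>2)"
        by (simp add: rotate_part_nth power_mult_distrib sum_distrib_left)
      then show "(\<Sum>j\<in>S. (rotate_part S c z$j)\<^sup>2) = (\<Sum>j\<in>S. (z$j)\<^sup>2)"
        using S by simp
    qed (simp add: rotate_part_nth)
    then show ?thesis
      using z that by (simp add: polygon_lifts_def rotate_part_nth norm_mult)
  qed
  moreover have "connected ((\<lambda>c. rotate_part S c z) ` sphere 0 1)"
  proof (rule connected_continuous_image)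
    show "continuous_on (sphere 0 1) (\<lambda>c. rotate_part S c z)"
      unfolding rotate_part_def
    proof (rule continuous_on_vec_lambda)
      show "continuous_on (sphere 0 1) (\<lambda>c. if l \<in> S then c * z$l else z$l)" for l
        by (cases "l \<in> S") (auto intro!: continuous_intros)
    qed
  qed (simp add: connected_sphere)
  moreover have "z = rotate_part S 1 z"
    by (simp add: rotate_part_def vec_eq_iff)
  ultimately show ?thesis
    unfolding connected_component_def using c
    by (intro exI[of _ "(\<lambda>c. rotate_part S c z) ` sphere 0 1"]) auto
qed

lemma square_root_path:
  fixes w :: "real \<Rightarrow> complex"
  assumes w: "continuous_on {0..1} w" "\<And>t. t \<in> {0..1} \<Longrightarrow> w t \<noteq> 0" and z: "w 0 = z\<^sup>2"
  shows "\<exists>h. continuous_on {0..1} h \<and> h 0 = z \<and> (\<forall>t\<in>{0..1}. (h t)\<^sup>2 = w t)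
           \<and> ((\<forall>t\<in>{0..1}. w t = z\<^sup>2) \<longrightarrow> h 1 = z)"
proof (cases "\<forall>t\<in>{0..1}. w t = z\<^sup>2")
  case True
  then show ?thesis by (intro exI[of _ "\<lambda>_. z"]) auto
next
  case False
  \<comment> \<open>take half of a continuous logarithm of \<open>w\<close>\<close>
  have "contractible {0..1::real}"
    by (simp add: convex_imp_contractible)
  then obtain g where g: "continuous_on {0..1} g" "\<And>t. t \<in> {0..1} \<Longrightarrow> w t = exp (g t)"
    using continuous_logarithm_on_contractible w by metis
  have "(z * exp ((g t - g 0) / 2))\<^sup>2 = w t" if "t \<in> {0..1}" for t
  proof -
    have "(exp ((g t - g 0) / 2))\<^sup>2 = exp (g t - g 0)"
      unfolding exp_double[symmetric] by (rule arg_cong[where f = exp]) (simp add: field_simps)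
    then have "(z * exp ((g t - g 0) / 2))\<^sup>2 = w 0 * exp (g t - g 0)"
      by (simp add: z power_mult_distrib)
    also have "\<dots> = w t"
      using g(2)[of 0] g(2)[OF that] by (simp add: exp_diff)
    finally show ?thesis .
  qed
  moreover have "continuous_on {0..1} (\<lambda>t. z * exp ((g t - g 0) / 2))"
    by (intro continuous_intros g(1)) auto
  ultimately show ?thesis
    using False by (intro exI[of _ "\<lambda>t. z * exp ((g t - g 0) / 2)"]) auto
qed

text \<open>A path of closed polygons lifts to a path of square roots. The lift is constant in the
  coordinates whose edge does not move.\<close>

lemma polygon_path_lift:
  fixes z :: "complex^'k" and W :: "real \<Rightarrow> 'k \<Rightarrow> complex"
  assumes cont: "\<And>j. continuous_on {0..1} (\<lambda>t. W t j)"
    and unit: "\<And>t j. t \<in> {0..1} \<Longrightarrow> norm (W t j) = 1"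
    and closed: "\<And>t. t \<in> {0..1} \<Longrightarrow> (\<Sum>j\<in>UNIV. W t j) = 0"
    and start: "\<And>j. W 0 j = (z$j)\<^sup>2"
  obtains y where "connected_component polygon_lifts z y" "\<And>j. (y$j)\<^sup>2 = W 1 j"
    "\<And>j. (\<And>t. t \<in> {0..1} \<Longrightarrow> W t j = (z$j)\<^sup>2) \<Longrightarrow> y$j = z$j"
proof -
  have "\<exists>h. continuous_on {0..1} h \<and> h 0 = z$j \<and> (\<forall>t\<in>{0..1}. (h t)\<^sup>2 = W t j)
           \<and> ((\<forall>t\<in>{0..1}. W t j = (z$j)\<^sup>2) \<longrightarrow> h 1 = z$j)" for j
  proof (rule square_root_path)
    show "W t j \<noteq> 0" if "t \<in> {0..1}" for t
      using unit[OF that, of j] by auto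
  qed (use cont start in auto)
  then obtain h where h: "\<And>j. continuous_on {0..1} (h j)" "\<And>j. h j 0 = z$j"
      "\<And>j t. t \<in> {0..1} \<Longrightarrow> (h j t)\<^sup>2 = W t j"
      "\<And>j. (\<forall>t\<in>{0..1}. W t j = (z$j)\<^sup>2) \<Longrightarrow> h j 1 = z$j"
    by metis
  define p where "p t = (\<chi> j. h j t)" for t
  have "continuous_on {0..1} p"
    unfolding p_def by (intro continuous_on_vec_lambda h(1))
  then have "connected (p ` {0..1})"
    by (intro connected_continuous_image) auto
  moreover have "p ` {0..1} \<subseteq> polygon_lifts"
  proof clarify
    fix t :: real assume t: "t \<in> {0..1}"
    have "norm (h j t) = 1" for j
    proof -
      have "(norm (h j t))\<^sup>2 = 1"
        using h(3)[OF t, of j] unit[OF t, of j] by (simp flip: norm_power)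
      then show ?thesis by (rule norm_eq_1_if_power2)
    qed
    then show "p t \<in> polygon_lifts"
      using h(3)[OF t] closed[OF t] by (simp add: polygon_lifts_def p_def)
  qed
  moreover have "z = p 0" using h(2) by (simp add: p_def vec_eq_iff)
  ultimately have "connected_component polygon_lifts z (p 1)"
    unfolding connected_component_def by (intro exI[of _ "p ` {0..1}"]) auto
  moreover have "(p 1 $ j)\<^sup>2 = W 1 j" for j
    using h(3)[of 1 j] by (simp add: p_def)
  ultimately show ?thesis
    using h(4) by (intro that[of "p 1"]) (auto simp: p_def)
qed

text \<open>For \<open>0 < norm s \<le> 2\<close> there are two unit vectors with sum \<open>s\<close>, namely the two sides of the rhombus
  with diagonal \<open>s\<close>; the sign \<open>\<kappa>\<close> selects one of them.\<close>

definition half_rhombus :: "real \<Rightarrow> complex \<Rightarrow> complex" where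
  "half_rhombus \<kappa> s =
     sgn s * (of_real (norm s / 2) + \<i> * of_real (\<kappa> * sqrt (1 - (norm s)\<^sup>2 / 4)))"

lemma sgn_times_norm: "sgn (s::complex) * of_real (norm s) = s"
  by (cases "s = 0") (simp_all add: sgn_eq)

lemma half_rhombus_add: "half_rhombus \<kappa> s + half_rhombus (- \<kappa>) s = s"
proof -
  have "half_rhombus \<kappa> s + half_rhombus (- \<kappa>) s = sgn s * of_real (norm s)"
    by (simp add: half_rhombus_def algebra_simps)
  then show ?thesis by (simp add: sgn_times_norm)
qed

lemma norm_half_rhombus:
  assumes "s \<noteq> 0" "norm s \<le> 2" "\<kappa> \<in> {1, -1}"
  shows "norm (half_rhombus \<kappa> s) = 1"
proof -
  have le: "(norm s)\<^sup>2 \<le> 4"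
    using power_mono[OF assms(2), of 2] by simp
  have "\<kappa>\<^sup>2 = 1" using assms(3) by auto
  let ?a = "complex_of_real (norm s / 2) + \<i> * of_real (\<kappa> * sqrt (1 - (norm s)\<^sup>2 / 4))"
  have "(norm ?a)\<^sup>2
      = (norm s / 2)\<^sup>2 + (\<kappa> * sqrt (1 - (norm s)\<^sup>2 / 4))\<^sup>2"
    by (simp add: cmod_power2)
  also have "\<dots> = 1"
    using le \<open>\<kappa>\<^sup>2 = 1\<close> by (simp add: power_mult_distrib power_divide)
  finally have "norm ?a = 1"
    by (rule norm_eq_1_if_power2)
  then show ?thesis
    unfolding half_rhombus_def norm_mult using assms(1) by (simp only: norm_sgn) simp
qed

lemma unit_pair_eq_half_rhombus:
  assumes u: "norm u = 1" and v: "norm v = 1" and nz: "u + v \<noteq> 0"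
  obtains \<kappa> where "\<kappa> \<in> {1, -1::real}" "u = half_rhombus \<kappa> (u + v)" "v = half_rhombus (- \<kappa>) (u + v)"
proof -
  define s where "s = u + v"
  define a where "a = u * cnj (sgn s)"
  define b where "b = v * cnj (sgn s)"
  have sgn1: "sgn s * cnj (sgn s) = 1"
    using nz by (simp add: s_def norm_sgn flip: complex_norm_square)
  have ab: "a + b = of_real (norm s)"
  proof -
    have "a + b = s * cnj (sgn s)"
      by (simp add: a_def b_def s_def algebra_simps)
    also have "\<dots> = (sgn s * cnj (sgn s)) * of_real (norm s)"
      by (subst sgn_times_norm[of s, symmetric]) simp
    finally show ?thesis using sgn1 by simp
  qed
  have na: "norm a = 1" "norm b = 1"
    using nz u v by (simp_all add: a_def b_def s_def norm_mult norm_sgn)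
  have re: "Re a + Re b = norm s" and im: "Im b = - Im a"
    using ab by (auto simp: complex_eq_iff)
  have sq: "(Re a)\<^sup>2 + (Im a)\<^sup>2 = 1" "(Re b)\<^sup>2 + (Im b)\<^sup>2 = 1"
    using na by (simp_all flip: cmod_power2)
  have "(Re a - Re b) * (Re a + Re b) = 0"
    using sq im by (simp add: algebra_simps power2_eq_square)
  moreover have "norm s > 0" using nz s_def by simp
  ultimately have reab: "Re a = norm s / 2" "Re b = norm s / 2"
    using re by auto
  have "(Im a)\<^sup>2 = 1 - (norm s)\<^sup>2 / 4"
    using sq(1) reab(1) by (simp add: power_divide)
  then have absim: "\<bar>Im a\<bar> = sqrt (1 - (norm s)\<^sup>2 / 4)"
    by (metis real_sqrt_abs)
  define \<kappa> :: real where "\<kappa> = (if Im a \<ge> 0 then 1 else -1)"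
  have ima: "Im a = \<kappa> * sqrt (1 - (norm s)\<^sup>2 / 4)"
    using absim by (auto simp: \<kappa>_def)
  have "u = sgn s * a" "v = sgn s * b"
    using sgn1 by (simp_all add: a_def b_def mult.left_commute)
  moreover have "a = of_real (norm s / 2) + \<i> * of_real (\<kappa> * sqrt (1 - (norm s)\<^sup>2 / 4))"
    using reab ima by (simp add: complex_eq_iff)
  moreover have "b = of_real (norm s / 2) + \<i> * of_real (- \<kappa> * sqrt (1 - (norm s)\<^sup>2 / 4))"
    using reab ima im by (simp add: complex_eq_iff)
  ultimately have "u = half_rhombus \<kappa> s" "v = half_rhombus (- \<kappa>) s"
    unfolding half_rhombus_def by simp_all
  moreover have "\<kappa> \<in> {1, -1}"
    by (simp add: \<kappa>_def)
  ultimately show ?thesis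
    using that unfolding s_def by blast
qed

lemma continuous_on_half_rhombus:
  assumes "continuous_on T s" "\<And>t. t \<in> T \<Longrightarrow> s t \<noteq> 0"
  shows "continuous_on T (\<lambda>t. half_rhombus \<kappa> (s t))"
  unfolding half_rhombus_def by (intro continuous_intros assms ballI) (use assms in auto)

section \<open>Moving a pair of edges into opposite position\<close>

lemma polygon_liftsD:
  assumes "z \<in> polygon_lifts"
  shows "norm (z$j) = 1" "z$j \<noteq> 0" "(\<Sum>j\<in>UNIV. (z$j)\<^sup>2) = 0"
  using assms by (auto simp: polygon_lifts_def) (metis norm_zero zero_neq_one)

lemma polygon_lifts_cong:
  assumes z: "z \<in> polygon_lifts" and "\<And>l. (z'$l)\<^sup>2 = (z$l)\<^sup>2"
  shows "z' \<in> polygon_lifts"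
proof -
  have "norm (z'$l) = 1" for l
  proof (rule norm_eq_1_if_power2)
    have "(norm (z'$l))\<^sup>2 = (norm (z$l))\<^sup>2"
      using assms(2)[of l] by (metis norm_power)
    then show "(norm (z'$l))\<^sup>2 = 1" using z by (simp add: polygon_liftsD)
  qed
  then show ?thesis using z assms(2) by (simp add: polygon_lifts_def)
qed

text \<open>If \<open>w a\<close> has positive inner product with the sum \<open>v\<close>, then so has the sum of \<open>w a + w b\<close> over all
  other \<open>b\<close>, hence one of its terms.\<close>

lemma exists_pair_with_positive_inner:
  fixes w :: "'k \<Rightarrow> 'a::real_inner"
  assumes "finite T" "card T \<ge> 2" "sum w T = v" "v \<noteq> 0"
  obtains a b where "a \<in> T" "b \<in> T" "a \<noteq> b" "(w a + w b) \<bullet> v > 0"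
proof -
  have total: "(\<Sum>a\<in>T. w a \<bullet> v) = v \<bullet> v"
    using assms(3) by (metis inner_sum_left)
  have "\<exists>a\<in>T. w a \<bullet> v > 0"
  proof (rule ccontr)
    assume "\<not> ?thesis"
    then have "(\<Sum>a\<in>T. w a \<bullet> v) \<le> 0" by (intro sum_nonpos) (auto simp: not_less)
    then show False using total assms(4) inner_gt_zero_iff[of v] by linarith
  qed
  then obtain a where a: "a \<in> T" "w a \<bullet> v > 0" by blast
  have "\<exists>b\<in>T - {a}. (w a + w b) \<bullet> v > 0"
  proof (rule ccontr)
    assume "\<not> ?thesis"
    then have "(\<Sum>b\<in>T - {a}. (w a + w b) \<bullet> v) \<le> 0" by (intro sum_nonpos) (auto simp: not_less)
    moreover have "(\<Sum>b\<in>T - {a}. (w a + w b) \<bullet> v)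
        = real (card (T - {a})) * (w a \<bullet> v) + (\<Sum>b\<in>T - {a}. w b \<bullet> v)"
      by (simp add: inner_add_left sum.distrib)
    moreover have "(\<Sum>b\<in>T - {a}. w b \<bullet> v) = v \<bullet> v - w a \<bullet> v"
      using total a(1) assms(1) by (simp add: sum_diff1)
    moreover have "real (card (T - {a})) \<ge> 1"
      using assms(1,2) a(1) by simp
    then have "real (card (T - {a})) * (w a \<bullet> v) \<ge> 1 * (w a \<bullet> v)"
      using a(2) by (intro mult_right_mono) auto
    ultimately have "v \<bullet> v \<le> 0" by linarith
    then show False using assms(4) inner_gt_zero_iff[of v] by linarith
  qed
  then show ?thesis using a that by blast
qed

text \<open>Let \<open>s \<noteq> 0\<close> be the sum of the edges \<open>i\<close> and \<open>j\<close>. The other edges in \<open>S\<close> have sum \<open>- s\<close>, so two of them,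
  \<open>a\<close> and \<open>b\<close>, have a sum \<open>P\<close> with \<open>P \<bullet> s < 0\<close>. Let the sum of \<open>a\<close> and \<open>b\<close> shrink to \<open>(1 - x) P\<close>; the sum of
  \<open>i\<close> and \<open>j\<close> becomes \<open>s + x P\<close>, which is shorter than \<open>s\<close> for small \<open>x > 0\<close>.\<close>

lemma shorten_pair_sum:
  fixes y :: "complex^'k"
  assumes y: "y \<in> polygon_lifts" and S: "(\<Sum>l\<in>S. (y$l)\<^sup>2) = 0"
    and ij: "i \<in> S" "j \<in> S" "i \<noteq> j" and card: "card S \<ge> 4"
    and nz: "(y$i)\<^sup>2 + (y$j)\<^sup>2 \<noteq> 0"
  obtains y' where "connected_component polygon_lifts y y'" "\<And>l. l \<notin> S \<Longrightarrow> y'$l = y$l"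
    "norm ((y'$i)\<^sup>2 + (y'$j)\<^sup>2) < norm ((y$i)\<^sup>2 + (y$j)\<^sup>2)"
proof -
  define T where "T = S - {i, j}"
  define s where "s = (y$i)\<^sup>2 + (y$j)\<^sup>2"
  have unit: "norm ((y$l)\<^sup>2) = 1" for l
    using polygon_liftsD(1)[OF y] by (simp add: norm_power)
  have "(\<Sum>l\<in>S. (y$l)\<^sup>2) = (\<Sum>l\<in>T. (y$l)\<^sup>2) + s"
    using sum.subset_diff[of "{i, j}" S "\<lambda>l. (y$l)\<^sup>2"] ij by (simp add: T_def s_def)
  then have sumT: "(\<Sum>l\<in>T. (y$l)\<^sup>2) = - s"
    using S by (simp add: eq_neg_iff_add_eq_0 add.commute)
  have "card T = card S - 2"
    using ij by (simp add: T_def card_Diff_subset)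
  then have "card T \<ge> 2" using card by simp
  then obtain a b where ab: "a \<in> T" "b \<in> T" "a \<noteq> b" "((y$a)\<^sup>2 + (y$b)\<^sup>2) \<bullet> (- s) > 0"
    using exists_pair_with_positive_inner[OF _ _ sumT] nz s_def by (metis finite neg_equal_0_iff_equal)
  define P where "P = (y$a)\<^sup>2 + (y$b)\<^sup>2"
  define c where "c = - (P \<bullet> s)"
  have c: "c > 0" using ab(4) by (simp add: c_def P_def)
  have P0: "P \<noteq> 0" using c by (auto simp: c_def)
  have PP: "P \<bullet> P > 0" using P0 by simp
  \<comment> \<open>the bound makes \<open>s + x P\<close> nonzero and shorter than \<open>s\<close>, and \<open>(1 - x) P\<close> nonzero, for \<open>0 < x \<le> \<delta>\<close>\<close>
  define \<delta> where "\<delta> = min (1/2) (c / (2 * (P \<bullet> P)))"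
  have \<delta>: "0 < \<delta>" "\<delta> \<le> 1/2" "\<delta> * (P \<bullet> P) \<le> c / 2"
    using c PP by (auto simp: \<delta>_def min_def field_simps)
  have len: "(norm (s + x *\<^sub>R P))\<^sup>2 \<le> (norm s)\<^sup>2 - x * c" if "0 \<le> x" "x \<le> \<delta>" for x
  proof -
    have "(norm (s + x *\<^sub>R P))\<^sup>2 = (norm s)\<^sup>2 - 2 * (x * c) + x * (x * (P \<bullet> P))"
      by (simp add: power2_norm_eq_inner c_def algebra_simps inner_commute)
    moreover have "x * (P \<bullet> P) \<le> \<delta> * (P \<bullet> P)"
      using that PP by (intro mult_right_mono) auto
    then have "x * (P \<bullet> P) \<le> c" using \<delta>(3) c by linarith
    then have "x * (x * (P \<bullet> P)) \<le> x * c" using that by (intro mult_left_mono) auto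
    ultimately show ?thesis by linarith
  qed
  have nonzero: "s + x *\<^sub>R P \<noteq> 0" if "0 \<le> x" "x \<le> \<delta>" for x
  proof
    assume "s + x *\<^sub>R P = 0"
    then have "P \<bullet> (s + x *\<^sub>R P) = 0" by simp
    then have "c = x * (P \<bullet> P)" by (simp add: c_def inner_add_right)
    also have "\<dots> \<le> \<delta> * (P \<bullet> P)" using that PP by (intro mult_right_mono) auto
    finally show False using \<delta>(3) c by linarith
  qed
  have "norm s \<le> 2" "norm P \<le> 2"
    using norm_triangle_ineq[of "(y$i)\<^sup>2" "(y$j)\<^sup>2"] norm_triangle_ineq[of "(y$a)\<^sup>2" "(y$b)\<^sup>2"]
    by (simp_all add: s_def P_def unit)
  \<comment> \<open>write both pairs as sides of rhombi, to let them follow their moving sums\<close>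
  obtain \<kappa> where \<kappa>: "\<kappa> \<in> {1, -1}" "(y$a)\<^sup>2 = half_rhombus \<kappa> P" "(y$b)\<^sup>2 = half_rhombus (- \<kappa>) P"
    using unit_pair_eq_half_rhombus[OF unit[of a] unit[of b]] P0 unfolding P_def by blast
  obtain \<mu> where \<mu>: "\<mu> \<in> {1, -1}" "(y$i)\<^sup>2 = half_rhombus \<mu> s" "(y$j)\<^sup>2 = half_rhombus (- \<mu>) s"
    using unit_pair_eq_half_rhombus[OF unit[of i] unit[of j]] nz unfolding s_def by blast
  define p where "p t = (1 - t * \<delta>) *\<^sub>R P" for t :: real
  define q where "q t = s + (t * \<delta>) *\<^sub>R P" for t :: real
  define W where "W t l = (if l = a then half_rhombus \<kappa> (p t) else if l = b then half_rhombus (- \<kappa>) (p t)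
      else if l = i then half_rhombus \<mu> (q t) else if l = j then half_rhombus (- \<mu>) (q t)
      else (y$l)\<^sup>2)" for t l
  have td: "0 \<le> t * \<delta>" "t * \<delta> \<le> \<delta>" "1 - t * \<delta> > 0" if "t \<in> {0..1}" for t
  proof -
    show le: "0 \<le> t * \<delta>" "t * \<delta> \<le> \<delta>"
      using that \<delta>(1) mult_right_mono[of t 1 \<delta>] by auto
    show "1 - t * \<delta> > 0" using le(2) \<delta>(2) by linarith
  qed
  have p: "p t \<noteq> 0" "norm (p t) \<le> 2" if "t \<in> {0..1}" for t
  proof -
    show "p t \<noteq> 0" using td[OF that] P0 by (simp add: p_def)
    have "norm (p t) = (1 - t * \<delta>) * norm P"
      using td(3)[OF that] by (simp add: p_def)
    also have "\<dots> \<le> 1 * norm P" using td[OF that] by (intro mult_right_mono) auto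
    finally show "norm (p t) \<le> 2" using \<open>norm P \<le> 2\<close> by simp
  qed
  have q: "q t \<noteq> 0" "norm (q t) \<le> 2" if "t \<in> {0..1}" for t
  proof -
    show "q t \<noteq> 0" using nonzero td[OF that] by (simp add: q_def)
    have "0 \<le> (t * \<delta>) * c" using td(1)[OF that] c by simp
    then have "(norm (q t))\<^sup>2 \<le> (norm s)\<^sup>2"
      using len[of "t * \<delta>"] td[OF that] unfolding q_def by linarith
    then have "norm (q t) \<le> norm s" by (rule power2_le_imp_le) simp
    then show "norm (q t) \<le> 2" using \<open>norm s \<le> 2\<close> by simp
  qed
  have distinct: "a \<noteq> i" "a \<noteq> j" "b \<noteq> i" "b \<noteq> j" using ab T_def by auto
  have contp: "continuous_on {0..1} (\<lambda>t. half_rhombus \<nu> (p t))"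
    and contq: "continuous_on {0..1} (\<lambda>t. half_rhombus \<nu> (q t))" for \<nu>
    by (intro continuous_on_half_rhombus p q; simp add: p_def q_def; intro continuous_intros)+
  have cont: "continuous_on {0..1} (\<lambda>t. W t l)" for l
    unfolding W_def
    by (cases "l = a"; cases "l = b"; cases "l = i"; cases "l = j") (simp_all add: contp contq)
  have "norm (W t l) = 1" if "t \<in> {0..1}" for t l
    using p[OF that] q[OF that] \<kappa>(1) \<mu>(1) unit by (auto simp: W_def intro!: norm_half_rhombus)
  moreover have "(\<Sum>l\<in>UNIV. W t l) = 0" for t
  proof -
    have "(\<Sum>l\<in>UNIV. W t l) = (\<Sum>l\<in>UNIV. (y$l)\<^sup>2)"
    proof (rule sum_modified_part[of "{a, b, i, j}"])
      have "sum (W t) {a, b, i, j} = (half_rhombus \<kappa> (p t) + half_rhombus (- \<kappa>) (p t))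
          + (half_rhombus \<mu> (q t) + half_rhombus (- \<mu>) (q t))"
        using distinct ab(3) ij(3) by (simp add: W_def)
      also have "\<dots> = p t + q t" by (simp only: half_rhombus_add)
      also have "\<dots> = P + s" by (simp add: p_def q_def algebra_simps)
      also have "\<dots> = (\<Sum>l\<in>{a, b, i, j}. (y$l)\<^sup>2)"
        using distinct ab(3) ij(3) by (simp add: P_def s_def)
      finally show "sum (W t) {a, b, i, j} = (\<Sum>l\<in>{a, b, i, j}. (y$l)\<^sup>2)" .
    qed (simp add: W_def)
    then show ?thesis using polygon_liftsD(3)[OF y] by simp
  qed
  moreover have "W 0 l = (y$l)\<^sup>2" for l
    using \<kappa>(2,3) \<mu>(2,3) by (simp add: W_def p_def q_def)
  ultimately obtain y' where y': "connected_component polygon_lifts y y'" "\<And>l. (y'$l)\<^sup>2 = W 1 l"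
    "\<And>l. (\<And>t. t \<in> {0..1} \<Longrightarrow> W t l = (y$l)\<^sup>2) \<Longrightarrow> y'$l = y$l"
    using polygon_path_lift[of W y] cont by blast
  have "y'$l = y$l" if "l \<notin> S" for l
    using that ab ij by (intro y'(3)) (auto simp: W_def T_def)
  moreover have "norm ((y'$i)\<^sup>2 + (y'$j)\<^sup>2) < norm s"
  proof -
    have "(y'$i)\<^sup>2 + (y'$j)\<^sup>2 = half_rhombus \<mu> (q 1) + half_rhombus (- \<mu>) (q 1)"
      using y'(2) distinct ij(3) by (simp add: W_def)
    also have "\<dots> = s + \<delta> *\<^sub>R P" by (simp only: half_rhombus_add) (simp add: q_def)
    finally have eq: "(y'$i)\<^sup>2 + (y'$j)\<^sup>2 = s + \<delta> *\<^sub>R P" .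
    have "(norm (s + \<delta> *\<^sub>R P))\<^sup>2 < (norm s)\<^sup>2"
      using len[of \<delta>] \<delta>(1) c mult_pos_pos[of \<delta> c] by linarith
    then show ?thesis unfolding eq by (rule power2_less_imp_less) simp
  qed
  ultimately show ?thesis using that y'(1) s_def by blast
qed

text \<open>Three unit vectors with sum zero have no antipodal pair, so \<open>card S = 3\<close> is excluded; for
  \<open>card S = 2\<close> there is nothing to do.\<close>

lemma exists_antipodal_pair:
  fixes z :: "complex^'k"
  assumes z: "z \<in> polygon_lifts" and S: "(\<Sum>l\<in>S. (z$l)\<^sup>2) = 0"
    and ij: "i \<in> S" "j \<in> S" "i \<noteq> j" and card: "card S \<noteq> 3"
  obtains y where "connected_component polygon_lifts z y" "\<And>l. l \<notin> S \<Longrightarrow> y$l = z$l"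
    "(y$i)\<^sup>2 + (y$j)\<^sup>2 = 0"
proof (cases "card S \<ge> 4")
  case False
  have "card {i, j} \<le> card S"
    using ij by (intro card_mono) auto
  then have "card S = card {i, j}" using False card ij(3) by auto
  then have "S = {i, j}"
    using card_seteq[of S "{i, j}"] ij by simp
  then have "(z$i)\<^sup>2 + (z$j)\<^sup>2 = 0" using S ij(3) by simp
  then show ?thesis
    using that[of z] z by simp
next
  case True
  define K where "K = connected_component_set polygon_lifts z \<inter> {y. \<forall>l\<in>-S. y$l = z$l}"
  have "compact (connected_component_set polygon_lifts z)"
    using compact_polygon_lifts closed_connected_component connected_component_subset
    by (metis compact_Int_closed compact_imp_closed inf.absorb_iff2)
  moreover have "closed {y. \<forall>l\<in>-S. y$l = z$l}"
    unfolding Collect_ball_eq by (intro closed_INT ballI closed_Collect_eq continuous_intros)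
  ultimately have "compact K" unfolding K_def by (rule compact_Int_closed)
  moreover have "z \<in> K" using z by (simp add: K_def)
  moreover have "continuous_on K (\<lambda>y. norm ((y$i)\<^sup>2 + (y$j)\<^sup>2))"
    by (intro continuous_intros)
  ultimately obtain y where y: "y \<in> K"
    and min: "\<And>y'. y' \<in> K \<Longrightarrow> norm ((y$i)\<^sup>2 + (y$j)\<^sup>2) \<le> norm ((y'$i)\<^sup>2 + (y'$j)\<^sup>2)"
    using continuous_attains_inf[of K] by blast
  have zy: "connected_component polygon_lifts z y" and off: "\<And>l. l \<notin> S \<Longrightarrow> y$l = z$l"
    using y by (auto simp: K_def)
  have yZ: "y \<in> polygon_lifts"
    using connected_component_in[OF zy] by simp
  have "(\<Sum>l\<in>S. (y$l)\<^sup>2) = (\<Sum>l\<in>S. (z$l)\<^sup>2)"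
    by (rule sum_agreeing_part) (simp_all add: off polygon_liftsD(3)[OF z] polygon_liftsD(3)[OF yZ])
  then have Sy: "(\<Sum>l\<in>S. (y$l)\<^sup>2) = 0" using S by simp
  have "(y$i)\<^sup>2 + (y$j)\<^sup>2 = 0"
  proof (rule ccontr)
    assume "(y$i)\<^sup>2 + (y$j)\<^sup>2 \<noteq> 0"
    then obtain y' where "connected_component polygon_lifts y y'" "\<And>l. l \<notin> S \<Longrightarrow> y'$l = y$l"
      and less: "norm ((y'$i)\<^sup>2 + (y'$j)\<^sup>2) < norm ((y$i)\<^sup>2 + (y$j)\<^sup>2)"
      using shorten_pair_sum[OF yZ Sy ij True] by blast
    then have "y' \<in> K"
      using zy off connected_component_trans by (fastforce simp: K_def)
    then show False using min less by fastforce
  qed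
  then show ?thesis using that zy off by blast
qed

section \<open>Connectedness of the space of polygons\<close>

text \<open>A symmetry \<open>g\<close> that preserves the component of one point of a component \<open>C\<close> preserves \<open>C\<close>. So to
  show that a symmetry preserves all components, one may first move to a convenient point.\<close>

lemma connected_component_conjugate:
  assumes "connected_component S z y" "continuous_on S g" "\<And>x. x \<in> S \<Longrightarrow> g x \<in> S"
    "connected_component S y (g y)"
  shows "connected_component S z (g z)"
proof -
  have "connected_component S (g z) (g y)"
    using assms(1-3) by (rule connected_component_image)
  then show ?thesis
    using assms(1,4) by (meson connected_component_sym connected_component_trans)
qed

text \<open>The sign change of the coordinates in \<open>D\<close>; it does not affect the polygon.\<close>

definition flip :: "'k set \<Rightarrow> complex^'k \<Rightarrow> complex^'k" where
  "flip D z = (\<chi> l. if l \<in> D then - z$l else z$l)"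

lemma flip_nth: "flip D z $ l = (if l \<in> D then - z$l else z$l)"
  by (simp add: flip_def)

lemma rotate_part_minus_one: "rotate_part D (-1) = flip D"
  by (simp add: fun_eq_iff rotate_part_def flip_def)

lemma flip_polygon_lifts: "z \<in> polygon_lifts \<Longrightarrow> flip D z \<in> polygon_lifts"
  by (erule polygon_lifts_cong) (simp add: flip_nth)

lemma continuous_on_flip: "continuous_on T (flip D)"
  unfolding flip_def
proof (rule continuous_on_vec_lambda)
  show "continuous_on T (\<lambda>z. if l \<in> D then - z$l else z$l)" for l
    by (cases "l \<in> D") (auto intro!: continuous_intros)
qed

text \<open>Once the edges \<open>i\<close> and \<open>j\<close> are antipodal, they can be rotated together through a full turn, which
  changes the sign of both square roots.\<close>

lemma flip_pair_connected:
  fixes z :: "complex^'k"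
  assumes z: "z \<in> polygon_lifts" and card: "CARD('k) \<noteq> 3" and ij: "i \<noteq> j"
  shows "connected_component polygon_lifts z (flip {i, j} z)"
proof -
  obtain y where y: "connected_component polygon_lifts z y" "(y$i)\<^sup>2 + (y$j)\<^sup>2 = 0"
    using exists_antipodal_pair[OF z polygon_liftsD(3)[OF z], of i j] card ij by auto
  have "connected_component polygon_lifts y (rotate_part {i, j} (-1) y)"
    using connected_component_in[OF y(1)] y(2) ij by (intro rotate_part_connected) auto
  then show ?thesis
    unfolding rotate_part_minus_one
    using connected_component_conjugate[OF y(1) continuous_on_flip flip_polygon_lifts] by blast
qed

lemma flip_even_connected:
  fixes z :: "complex^'k"
  assumes "z \<in> polygon_lifts" and card: "CARD('k) \<noteq> 3" and "even (card D)"
  shows "connected_component polygon_lifts z (flip D z)"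
  using assms(1,3)
proof (induction "card D" arbitrary: D z rule: less_induct)
  case less
  show ?case
  proof (cases "D = {}")
    case True
    then show ?thesis using less.prems by (simp add: flip_def)
  next
    case False
    then obtain i where i: "i \<in> D" by blast
    have "D \<noteq> {i}"
      using less.prems(2) by auto
    with i obtain j where j: "j \<in> D" "j \<noteq> i" by blast
    let ?D = "D - {i, j}"
    have card_D: "card ?D = card D - 2" "card D \<ge> 2"
      using i j card_Diff_subset[of "{i, j}" D] card_mono[of D "{i, j}"] by simp_all
    have "connected_component polygon_lifts z (flip {i, j} z)"
      using j(2) by (intro flip_pair_connected[OF less.prems(1) card]) simp
    moreover have "connected_component polygon_lifts (flip {i, j} z) (flip ?D (flip {i, j} z))"
      using card_D less.prems by (intro less.hyps flip_polygon_lifts) simp_all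
    moreover have "flip ?D (flip {i, j} z) = flip D z"
      using i j by (auto simp: vec_eq_iff flip_nth)
    ultimately show ?thesis by (metis connected_component_trans)
  qed
qed

text \<open>Three half turns of antipodal pairs, namely of \<open>{c, d}\<close>, of \<open>{b, d}\<close> and, backwards, of \<open>{b, c}\<close>,
  return every edge to its place, but \<open>d\<close> has made a full turn. A half turn of an edge multiplies
  its square root by \<open>\<i>\<close>.\<close>

lemma flip_single_two_antipodal_pairs:
  fixes z :: "complex^'k"
  assumes z: "z \<in> polygon_lifts" and dist: "distinct [a, b, c, d]"
    and ab: "(z$a)\<^sup>2 + (z$b)\<^sup>2 = 0" and cd: "(z$c)\<^sup>2 + (z$d)\<^sup>2 = 0" and ac: "z$c = z$a"
  shows "connected_component polygon_lifts z (flip {d} z)"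
proof -
  define y1 where "y1 = rotate_part {c, d} \<i> z"
  define y2 where "y2 = rotate_part {b, d} \<i> y1"
  define y3 where "y3 = rotate_part {b, c} (- \<i>) y2"
  have sq: "(z$b)\<^sup>2 = - ((z$a)\<^sup>2)" "(z$d)\<^sup>2 = - ((z$a)\<^sup>2)"
    using ab cd ac by (simp_all add: eq_neg_iff_add_eq_0 add.commute)
  have 1: "connected_component polygon_lifts z y1"
    unfolding y1_def using z dist cd by (intro rotate_part_connected) auto
  have 2: "connected_component polygon_lifts y1 y2"
    unfolding y2_def using connected_component_in[OF 1] dist sq
    by (intro rotate_part_connected) (auto simp: y1_def rotate_part_nth power_mult_distrib)
  have 3: "connected_component polygon_lifts y2 y3"
    unfolding y3_def using connected_component_in[OF 2] dist sq ac
    by (intro rotate_part_connected)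
      (auto simp: y2_def y1_def rotate_part_nth power_mult_distrib)
  have "y3 = flip {d} z"
    using dist by (auto simp: vec_eq_iff flip_nth y3_def y2_def y1_def rotate_part_nth)
  then show ?thesis using 1 2 3 connected_component_trans by metis
qed

text \<open>If the number of edges is odd, a full turn of the whole polygon changes an odd number of signs.
  If it is even, two antipodal pairs are available.\<close>

lemma flip_single_connected:
  fixes z :: "complex^'k"
  assumes z: "z \<in> polygon_lifts" and card: "CARD('k) \<ge> 4"
  shows "connected_component polygon_lifts z (flip {d} z)"
proof (cases "even CARD('k)")
  case False
  have "connected_component polygon_lifts z (rotate_part UNIV (-1) z)"
    using polygon_liftsD(3)[OF z] by (intro rotate_part_connected[OF z]) auto
  moreover have "connected_component polygon_lifts (flip UNIV z) (flip (- {d}) (flip UNIV z))"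
    using False card z
    by (intro flip_even_connected flip_polygon_lifts) (simp_all add: Compl_eq_Diff_UNIV card_Diff_subset)
  moreover have "flip (- {d}) (flip UNIV z) = flip {d} z"
    by (auto simp: vec_eq_iff flip_nth)
  ultimately show ?thesis
    unfolding rotate_part_minus_one by (metis connected_component_trans)
next
  case True
  \<comment> \<open>make \<open>{a, b}\<close> antipodal, then \<open>{c, d}\<close>, then align \<open>c\<close> with \<open>a\<close>\<close>
  have "3 \<le> card (- {d})"
    using card by (simp add: Compl_eq_Diff_UNIV card_Diff_subset)
  then obtain X where X: "card X = 3" "X \<subseteq> - {d}"
    using obtain_subset_with_card_n by metis
  then obtain a b c where abc: "X = {a, b, c}" "a \<noteq> b" "a \<noteq> c" "b \<noteq> c"
    by (auto simp: card_3_iff)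
  then have dist: "distinct [a, b, c, d]" using X by auto
  obtain y1 where y1: "connected_component polygon_lifts z y1" "(y1$a)\<^sup>2 + (y1$b)\<^sup>2 = 0"
    using exists_antipodal_pair[OF z polygon_liftsD(3)[OF z], of a b] card abc(2) by auto
  have y1Z: "y1 \<in> polygon_lifts" using connected_component_in[OF y1(1)] by simp
  have "(\<Sum>l\<in>-{a, b}. (y1$l)\<^sup>2) = 0"
    using polygon_liftsD(3)[OF y1Z] y1(2) abc(2)
    by (simp add: Compl_eq_Diff_UNIV sum_diff)
  moreover have "card (- {a, b}) \<noteq> 3"
    using True abc(2) card by (simp add: Compl_eq_Diff_UNIV card_Diff_subset) presburger
  moreover have "c \<in> - {a, b}" "d \<in> - {a, b}" "c \<noteq> d" using dist by auto
  ultimately obtain y2 where y2: "connected_component polygon_lifts y1 y2"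
    "\<And>l. l \<notin> - {a, b} \<Longrightarrow> y2$l = y1$l" "(y2$c)\<^sup>2 + (y2$d)\<^sup>2 = 0"
    using exists_antipodal_pair[OF y1Z, of "- {a, b}" c d] by blast
  have y2Z: "y2 \<in> polygon_lifts" using connected_component_in[OF y2(1)] by simp
  have y2ab: "(y2$a)\<^sup>2 + (y2$b)\<^sup>2 = 0" using y2(2) y1(2) by simp
  define y3 where "y3 = rotate_part {c, d} (y2$a / y2$c) y2"
  have y3: "connected_component polygon_lifts y2 y3"
    unfolding y3_def using y2(3) dist polygon_liftsD(1)[OF y2Z]
    by (intro rotate_part_connected[OF y2Z]) (auto simp: norm_divide)
  have "(y3$c)\<^sup>2 + (y3$d)\<^sup>2 = (y2$a / y2$c)\<^sup>2 * ((y2$c)\<^sup>2 + (y2$d)\<^sup>2)"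
    using dist by (simp add: y3_def rotate_part_nth power_mult_distrib power_divide distrib_left)
  then have "(y3$c)\<^sup>2 + (y3$d)\<^sup>2 = 0" using y2(3) by simp
  moreover have "(y3$a)\<^sup>2 + (y3$b)\<^sup>2 = 0"
    using y2ab dist by (simp add: y3_def rotate_part_nth)
  moreover have "y3$c = y3$a"
    using dist polygon_liftsD(2)[OF y2Z] by (simp add: y3_def rotate_part_nth)
  ultimately have "connected_component polygon_lifts y3 (flip {d} y3)"
    using connected_component_in[OF y3] dist by (intro flip_single_two_antipodal_pairs[of y3 a b c d]) simp_all
  moreover have "connected_component polygon_lifts z y3"
    using y1(1) y2(1) y3 by (meson connected_component_trans)
  ultimately show ?thesis
    using connected_component_conjugate[OF _ continuous_on_flip flip_polygon_lifts] by blast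
qed

lemma same_squares_connected:
  fixes z z' :: "complex^'k"
  assumes z: "z \<in> polygon_lifts" and card: "CARD('k) \<ge> 4"
    and sq: "\<And>l. (z'$l)\<^sup>2 = (z$l)\<^sup>2"
  shows "connected_component polygon_lifts z z'"
proof -
  have "connected_component polygon_lifts z (flip D z)" if "finite D" for D
    using that
  proof induction
    case empty
    then show ?case using z by (simp add: flip_def)
  next
    case (insert d D)
    have "connected_component polygon_lifts (flip D z) (flip {d} (flip D z))"
      using z by (intro flip_single_connected[OF _ card] flip_polygon_lifts)
    moreover have "flip {d} (flip D z) = flip (insert d D) z"
      using insert.hyps by (auto simp: vec_eq_iff flip_nth)
    ultimately show ?case using insert.IH by (metis connected_component_trans)
  qed
  moreover have "z' = flip {l. z'$l \<noteq> z$l} z"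
    using sq by (auto simp: vec_eq_iff flip_nth power2_eq_iff)
  ultimately show ?thesis by (metis finite)
qed

definition swap_coords :: "'k \<Rightarrow> 'k \<Rightarrow> 'a^'k \<Rightarrow> 'a^'k" where
  "swap_coords i j z = (\<chi> l. if l = i then z$j else if l = j then z$i else z$l)"

lemma swap_coords_polygon_lifts:
  fixes z :: "complex^'k"
  assumes z: "z \<in> polygon_lifts"
  shows "swap_coords i j z \<in> polygon_lifts"
proof -
  have "(\<Sum>l\<in>UNIV. (swap_coords i j z $ l)\<^sup>2) = (\<Sum>l\<in>UNIV. (z$l)\<^sup>2)"
    by (rule sum_modified_part[of "{i, j}"], simp add: swap_coords_def, cases "i = j")
      (simp_all add: swap_coords_def add.commute)
  then show ?thesis
    using z by (auto simp: polygon_lifts_def swap_coords_def)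
qed

lemma continuous_on_swap_coords: 
  "continuous_on T (swap_coords i j :: 'a::topological_space^'k \<Rightarrow> 'a^'k)"
  unfolding swap_coords_def
proof (rule continuous_on_vec_lambda)
  show "continuous_on T (\<lambda>z::'a^'k. if l = i then z$j else if l = j then z$i else z$l)" for l
    by (cases "l = i"; cases "l = j") (auto intro!: continuous_intros)
qed

text \<open>Let \<open>i\<close> be antipodal to some third edge \<open>j\<close> and rotate this pair until the coordinates \<open>i\<close> and \<open>l\<close>
  agree. This point is fixed by the exchange.\<close>

lemma swap_coords_connected:
  fixes z :: "complex^'k"
  assumes z: "z \<in> polygon_lifts" and card: "CARD('k) \<ge> 4" and il: "i \<noteq> l"
  shows "connected_component polygon_lifts z (swap_coords i l z)"
proof -
  have "{i, l} \<noteq> UNIV"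
  proof
    assume "{i, l} = UNIV"
    then have "card {i, l} \<ge> 4" using card by simp
    then show False using il by simp
  qed
  then obtain j where j: "j \<noteq> i" "j \<noteq> l" by blast
  obtain y where y: "connected_component polygon_lifts z y" "(y$i)\<^sup>2 + (y$j)\<^sup>2 = 0"
    using exists_antipodal_pair[OF z polygon_liftsD(3)[OF z], of i j] card j by auto
  have yZ: "y \<in> polygon_lifts" using connected_component_in[OF y(1)] by simp
  define u where "u = rotate_part {i, j} (y$l / y$i) y"
  have u: "connected_component polygon_lifts y u"
    unfolding u_def using y(2) j polygon_liftsD(1)[OF yZ]
    by (intro rotate_part_connected[OF yZ]) (auto simp: norm_divide)
  have "u$i = u$l"
    using il j polygon_liftsD(2)[OF yZ] by (simp add: u_def rotate_part_nth)
  then have "swap_coords i l u = u" by (auto simp: swap_coords_def vec_eq_iff)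
  moreover have "u \<in> polygon_lifts" using connected_component_in[OF u] by simp
  moreover have "connected_component polygon_lifts z u"
    using y(1) u by (rule connected_component_trans)
  ultimately show ?thesis
    using connected_component_conjugate[OF _ continuous_on_swap_coords swap_coords_polygon_lifts, of z u]
    by simp
qed

text \<open>Two points that agree outside \<open>S\<close> are joined by induction on \<open>card S\<close>. In both points a pair \<open>i\<close>, \<open>j\<close>
  in \<open>S\<close> is made antipodal and rotated into the same position, which leaves \<open>S - {i, j}\<close>. If \<open>S\<close> has
  three elements, its edges form an equilateral triangle; after a rotation the two triangles agree
  or differ by an exchange of two edges.\<close>

lemma connected_component_agree_off:
  fixes z z' :: "complex^'k"
  assumes "z \<in> polygon_lifts" "z' \<in> polygon_lifts" and card: "CARD('k) \<ge> 4"
    and "\<And>l. l \<notin> S \<Longrightarrow> z$l = z'$l" "(\<Sum>l\<in>S. (z$l)\<^sup>2) = 0"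
  shows "connected_component polygon_lifts z z'"
  using assms(1,2,4,5)
proof (induction "card S" arbitrary: S z z' rule: less_induct)
  case less
  note z = less.prems(1) and z' = less.prems(2) and off = less.prems(3) and Sz = less.prems(4)
  have "(\<Sum>l\<in>S. (z'$l)\<^sup>2) = (\<Sum>l\<in>S. (z$l)\<^sup>2)"
    by (rule sum_agreeing_part) (simp_all add: off polygon_liftsD(3)[OF z] polygon_liftsD(3)[OF z'])
  then have Sz': "(\<Sum>l\<in>S. (z'$l)\<^sup>2) = 0" using Sz by simp
  consider "S = {}" | "card S = 3" | "S \<noteq> {}" "card S \<noteq> 3" by blast
  then show ?case
  proof cases
    case 1
    then have "z = z'" using off by (simp add: vec_eq_iff)
    then show ?thesis using z by simp
  next
    case 2
    then obtain i j l where S: "S = {i, j, l}" and ne: "i \<noteq> j" "i \<noteq> l" "j \<noteq> l"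
      by (auto simp: card_3_iff)
    define u where "u = rotate_part S (z'$i / z$i) z"
    have zu: "connected_component polygon_lifts z u"
      unfolding u_def using polygon_liftsD(1)[OF z] polygon_liftsD(1)[OF z']
      by (intro rotate_part_connected[OF z Sz]) (simp add: norm_divide)
    have uZ: "u \<in> polygon_lifts" using connected_component_in[OF zu] by simp
    have ui: "u$i = z'$i"
      using polygon_liftsD(2)[OF z] S by (simp add: u_def rotate_part_nth)
    have uoff: "u$m = z'$m" if "m \<notin> S" for m
      using off[OF that] that by (simp add: u_def rotate_part_nth)
    have "(\<Sum>l\<in>S. (u$l)\<^sup>2) = (\<Sum>l\<in>S. (z'$l)\<^sup>2)"
      by (rule sum_agreeing_part) (simp_all add: uoff polygon_liftsD(3)[OF uZ] polygon_liftsD(3)[OF z'])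
    then have sums: "(u$j)\<^sup>2 + (u$l)\<^sup>2 = (z'$j)\<^sup>2 + (z'$l)\<^sup>2"
      using ne by (simp add: S ui)
    have "(z'$j)\<^sup>2 + (z'$l)\<^sup>2 = - ((z'$i)\<^sup>2)"
      using Sz' ne by (simp add: S eq_neg_iff_add_eq_0 ac_simps)
    then have nz: "(z'$j)\<^sup>2 + (z'$l)\<^sup>2 \<noteq> 0"
      using polygon_liftsD(2)[OF z'] by simp
    have unit: "norm ((u$m)\<^sup>2) = 1" "norm ((z'$m)\<^sup>2) = 1" for m
      using polygon_liftsD(1)[OF uZ] polygon_liftsD(1)[OF z'] by (simp_all add: norm_power)
    obtain \<kappa> where \<kappa>: "\<kappa> \<in> {1, -1}" "(u$j)\<^sup>2 = half_rhombus \<kappa> ((u$j)\<^sup>2 + (u$l)\<^sup>2)"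
        "(u$l)\<^sup>2 = half_rhombus (- \<kappa>) ((u$j)\<^sup>2 + (u$l)\<^sup>2)"
      using unit_pair_eq_half_rhombus[OF unit(1)[of j] unit(1)[of l]] nz sums by auto
    obtain \<mu> where \<mu>: "\<mu> \<in> {1, -1}" "(z'$j)\<^sup>2 = half_rhombus \<mu> ((z'$j)\<^sup>2 + (z'$l)\<^sup>2)"
        "(z'$l)\<^sup>2 = half_rhombus (- \<mu>) ((z'$j)\<^sup>2 + (z'$l)\<^sup>2)"
      using unit_pair_eq_half_rhombus[OF unit(2)[of j] unit(2)[of l]] nz by blast
    have "\<mu> = \<kappa> \<or> \<mu> = - \<kappa>" using \<kappa>(1) \<mu>(1) by auto
    then consider "(z'$j)\<^sup>2 = (u$j)\<^sup>2" "(z'$l)\<^sup>2 = (u$l)\<^sup>2" | "(z'$j)\<^sup>2 = (u$l)\<^sup>2" "(z'$l)\<^sup>2 = (u$j)\<^sup>2"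
      using \<kappa>(2,3) \<mu>(2,3) sums by (metis minus_minus)
    then have "connected_component polygon_lifts u z'"
    proof cases
      case 1
      then have "(z'$m)\<^sup>2 = (u$m)\<^sup>2" for m
        using uoff[of m] ui S by (cases "m \<in> S") auto
      then show ?thesis by (rule same_squares_connected[OF uZ card])
    next
      case 2
      have "connected_component polygon_lifts u (swap_coords j l u)"
        using swap_coords_connected[OF uZ card ne(3)] .
      moreover have "(z'$m)\<^sup>2 = (swap_coords j l u $ m)\<^sup>2" for m
        using uoff[of m] ui S 2 ne by (cases "m \<in> S") (auto simp: swap_coords_def)
      then have "connected_component polygon_lifts (swap_coords j l u) z'"
        using uZ by (intro same_squares_connected[OF _ card] swap_coords_polygon_lifts)
      ultimately show ?thesis by (rule connected_component_trans)
    qed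
    then show ?thesis using zu by (meson connected_component_trans)
  next
    case 3
    then obtain i where i: "i \<in> S" by blast
    have "S \<noteq> {i}" using Sz polygon_liftsD(2)[OF z] by auto
    then obtain j where j: "j \<in> S" "i \<noteq> j" using i by blast
    obtain y where y: "connected_component polygon_lifts z y" "\<And>l. l \<notin> S \<Longrightarrow> y$l = z$l"
        "(y$i)\<^sup>2 + (y$j)\<^sup>2 = 0"
      using exists_antipodal_pair[OF z Sz i j 3(2)] by blast
    obtain y' where y': "connected_component polygon_lifts z' y'" "\<And>l. l \<notin> S \<Longrightarrow> y'$l = z'$l"
        "(y'$i)\<^sup>2 + (y'$j)\<^sup>2 = 0"
      using exists_antipodal_pair[OF z' Sz' i j 3(2)] by blast
    have yZ: "y \<in> polygon_lifts" "y' \<in> polygon_lifts"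
      using connected_component_in[OF y(1)] connected_component_in[OF y'(1)] by simp_all
    define u where "u = rotate_part {i, j} (y'$i / y$i) y"
    have yu: "connected_component polygon_lifts y u"
      unfolding u_def using y(3) j polygon_liftsD(1)[OF yZ(1)] polygon_liftsD(1)[OF yZ(2)]
      by (intro rotate_part_connected[OF yZ(1)]) (auto simp: norm_divide)
    have uZ: "u \<in> polygon_lifts" using connected_component_in[OF yu] by simp
    have ui: "u$i = y'$i"
      using polygon_liftsD(2)[OF yZ(1)] by (simp add: u_def rotate_part_nth)
    have "(u$i)\<^sup>2 + (u$j)\<^sup>2 = (y'$i / y$i)\<^sup>2 * ((y$i)\<^sup>2 + (y$j)\<^sup>2)"
      by (simp add: u_def rotate_part_nth power_mult_distrib power_divide distrib_left)
    then have "(u$i)\<^sup>2 + (u$j)\<^sup>2 = (y'$i)\<^sup>2 + (y'$j)\<^sup>2" using y(3) y'(3) by simp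
    then have uj: "(y'$j)\<^sup>2 = (u$j)\<^sup>2" using ui by simp
    define v where "v = (\<chi> l. if l = j then y'$j else u$l)"
    have sq: "(v$l)\<^sup>2 = (u$l)\<^sup>2" for l using uj by (simp add: v_def)
    have uv: "connected_component polygon_lifts u v"
      by (rule same_squares_connected[OF uZ card sq])
    have vZ: "v \<in> polygon_lifts" using connected_component_in[OF uv] by simp
    let ?S = "S - {i, j}"
    have "connected_component polygon_lifts v y'"
    proof (rule less.hyps)
      show "card ?S < card S" using i by (intro psubset_card_mono) auto
      show "v$l = y'$l" if "l \<notin> ?S" for l
        using that ui y(2) y'(2) off by (auto simp: v_def u_def rotate_part_nth)
      have "(\<Sum>l\<in>S. (v$l)\<^sup>2) = (\<Sum>l\<in>S. (z$l)\<^sup>2)"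
      proof (rule sum_agreeing_part)
        show "(v$l)\<^sup>2 = (z$l)\<^sup>2" if "l \<notin> S" for l
          using that i j y(2) by (auto simp: v_def u_def rotate_part_nth)
      qed (simp add: polygon_liftsD(3)[OF z] polygon_liftsD(3)[OF vZ])
      moreover have "(v$i)\<^sup>2 + (v$j)\<^sup>2 = 0" using ui j y'(3) by (simp add: v_def)
      ultimately show "(\<Sum>l\<in>?S. (v$l)\<^sup>2) = 0"
        using sum.subset_diff[of "{i, j}" S "\<lambda>l. (v$l)\<^sup>2"] i j Sz by simp
    qed (use vZ yZ in simp_all)
    then show ?thesis
      using y(1) y'(1) yu uv by (meson connected_component_sym connected_component_trans)
  qed
qed

lemma connected_polygon_lifts:
  assumes "CARD('k::finite) \<ge> 4"
  shows "connected (polygon_lifts :: (complex^'k) set)"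
  unfolding connected_iff_connected_component
proof (intro ballI)
  fix z z' :: "complex^'k"
  assume "z \<in> polygon_lifts" "z' \<in> polygon_lifts"
  then show "connected_component polygon_lifts z z'"
    using connected_component_agree_off[of z z' UNIV] assms polygon_liftsD(3) by auto
qed

section \<open>From polygons to tight frames\<close>

lemma norm_vec_le_sum: "norm (x::'a::real_normed_vector^'k) \<le> (\<Sum>i\<in>UNIV. norm (x$i))"
  unfolding norm_vec_def by (rule L2_set_le_sum) simp

text \<open>The rotations whose rows other than \<open>p\<close> and \<open>q\<close> form, up to scaling, a tight frame of unit
  vectors: the columns of these rows have squared length \<open>1 - 2 / k\<close>.\<close>

definition rotations_with_balanced_rows :: "'k \<Rightarrow> 'k \<Rightarrow> (real^'k^'k) set" where
  "rotations_with_balanced_rows p q =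
     {M. rotation_matrix M \<and> (\<forall>i. (M$p$i)\<^sup>2 + (M$q$i)\<^sup>2 = 2 / real CARD('k))}"

text \<open>The rows \<open>p\<close> and \<open>q\<close> as real and imaginary parts, rescaled to coordinates of modulus 1.\<close>

definition row_pair :: "'k \<Rightarrow> 'k \<Rightarrow> real^'k^'k \<Rightarrow> complex^'k" where
  "row_pair p q M = (\<chi> i. of_real (sqrt (real CARD('k) / 2)) * Complex (M$p$i) (M$q$i))"

lemma compact_rotations_with_balanced_rows:
  "compact (rotations_with_balanced_rows p q :: (real^'k^'k) set)"
proof -
  have "rotations_with_balanced_rows p q =
      {M::real^'k^'k. \<forall>i j. M$i \<bullet> M$j = (if i = j then 1 else 0)} \<inter> {M. det M = 1}
      \<inter> {M. \<forall>i. (M$p$i)\<^sup>2 + (M$q$i)\<^sup>2 = 2 / real CARD('k)}"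
    by (auto simp: rotations_with_balanced_rows_def rotation_matrix_def orthogonal_matrix_iff_inner_rows)
  moreover have "closed \<dots>"
    by (intro closed_Int closed_Collect_all closed_Collect_eq continuous_intros continuous_on_det)
  moreover have "bounded (rotations_with_balanced_rows p q :: (real^'k^'k) set)"
    unfolding bounded_iff
  proof (intro exI ballI)
    fix M :: "real^'k^'k" assume "M \<in> rotations_with_balanced_rows p q"
    then have "norm (M$j) = 1" for j
      by (simp add: rotations_with_balanced_rows_def rotation_matrix_def
          orthogonal_matrix_iff_inner_rows norm_eq_1)
    then show "norm M \<le> real CARD('k)"
      using norm_vec_le_sum[of M] by simp
  qed
  ultimately show ?thesis by (simp add: compact_eq_bounded_closed)
qed

lemma row_pair_image:
  assumes card: "CARD('k) \<ge> 3" and pq: "p \<noteq> q"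
  shows "row_pair p q ` rotations_with_balanced_rows p q = (polygon_lifts :: (complex^'k) set)"
proof (intro equalityI subsetI)
  define c where "c = sqrt (real CARD('k) / 2)"
  have c: "c > 0" "c\<^sup>2 = real CARD('k) / 2" by (simp_all add: c_def)
  fix z :: "complex^'k"
  {
    assume "z \<in> row_pair p q ` rotations_with_balanced_rows p q"
    then obtain M :: "real^'k^'k" where M: "rotation_matrix M"
      "\<And>i. (M$p$i)\<^sup>2 + (M$q$i)\<^sup>2 = 2 / real CARD('k)"
      and z: "\<And>i. z$i = of_real c * Complex (M$p$i) (M$q$i)"
      by (auto simp: rotations_with_balanced_rows_def row_pair_def c_def)
    have inner: "M$a \<bullet> M$b = (if a = b then 1 else 0)" for a b
      using M(1) by (simp add: orthogonal_matrix_iff_inner_rows rotation_matrix_def)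
    have "norm (z$i) = 1" for i
    proof (rule norm_eq_1_if_power2)
      have "(norm (z$i))\<^sup>2 = c\<^sup>2 * ((M$p$i)\<^sup>2 + (M$q$i)\<^sup>2)"
        by (simp add: z norm_mult power_mult_distrib cmod_power2)
      then show "(norm (z$i))\<^sup>2 = 1" by (simp add: M(2) c)
    qed
    moreover have "(\<Sum>i\<in>UNIV. (z$i)\<^sup>2) = 0"
    proof -
      have sq: "(z$i)\<^sup>2 = of_real (c\<^sup>2) *
          Complex (M$p$i * M$p$i - M$q$i * M$q$i) (2 * (M$p$i * M$q$i))" for i
        by (simp add: z power2_eq_square complex_eq_iff algebra_simps)
      have "(\<Sum>i\<in>UNIV. (z$i)\<^sup>2) = of_real (c\<^sup>2) *
          (\<Sum>i\<in>UNIV. Complex (M$p$i * M$p$i - M$q$i * M$q$i) (2 * (M$p$i * M$q$i)))"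
        unfolding sq by (simp only: sum_distrib_left)
      also have "(\<Sum>i\<in>UNIV. Complex (M$p$i * M$p$i - M$q$i * M$q$i) (2 * (M$p$i * M$q$i)))
          = Complex (M$p \<bullet> M$p - M$q \<bullet> M$q) (2 * (M$p \<bullet> M$q))"
        by (simp add: complex_eq_iff inner_vec_def sum_subtractf sum_distrib_left)
      also have "\<dots> = 0" using pq by (simp add: inner complex_eq_iff)
      finally show ?thesis by simp
    qed
    ultimately show "z \<in> polygon_lifts" by (simp add: polygon_lifts_def)
  next
    assume z: "z \<in> polygon_lifts"
    define x where "x = (\<chi> i. Re (z$i) / c)"
    define y where "y = (\<chi> i. Im (z$i) / c)"
    have norms: "(Re (z$i))\<^sup>2 + (Im (z$i))\<^sup>2 = 1" for i
      using polygon_liftsD(1)[OF z, of i] by (simp flip: cmod_power2)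
    have "(\<Sum>i\<in>UNIV. (Re (z$i))\<^sup>2) + (\<Sum>i\<in>UNIV. (Im (z$i))\<^sup>2) = real CARD('k)"
      by (simp add: norms flip: sum.distrib)
    moreover have "(\<Sum>i\<in>UNIV. (Re (z$i))\<^sup>2) - (\<Sum>i\<in>UNIV. (Im (z$i))\<^sup>2) = Re (\<Sum>i\<in>UNIV. (z$i)\<^sup>2)"
      by (simp add: power2_eq_square sum_subtractf)
    ultimately have sums: "(\<Sum>i\<in>UNIV. (Re (z$i))\<^sup>2) = c\<^sup>2" "(\<Sum>i\<in>UNIV. (Im (z$i))\<^sup>2) = c\<^sup>2"
      using polygon_liftsD(3)[OF z] c by simp_all
    have "2 * (\<Sum>i\<in>UNIV. Re (z$i) * Im (z$i)) = Im (\<Sum>i\<in>UNIV. (z$i)\<^sup>2)"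
      by (simp add: power2_eq_square sum_distrib_left mult.commute)
    then have mixed: "(\<Sum>i\<in>UNIV. Re (z$i) * Im (z$i)) = 0"
      using polygon_liftsD(3)[OF z] by simp
    have xx: "x \<bullet> x = 1" and yy: "y \<bullet> y = 1" and xy: "x \<bullet> y = 0" "y \<bullet> x = 0"
    proof -
      have "x \<bullet> x = (\<Sum>i\<in>UNIV. (Re (z$i))\<^sup>2) / c\<^sup>2" "y \<bullet> y = (\<Sum>i\<in>UNIV. (Im (z$i))\<^sup>2) / c\<^sup>2"
        by (simp_all add: x_def y_def inner_vec_def power2_eq_square sum_divide_distrib)
      then show "x \<bullet> x = 1" "y \<bullet> y = 1" using sums c by simp_all
      have "x \<bullet> y = (\<Sum>i\<in>UNIV. Re (z$i) * Im (z$i)) / c\<^sup>2"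
        by (simp add: x_def y_def inner_vec_def power2_eq_square sum_divide_distrib)
      then show "x \<bullet> y = 0" "y \<bullet> x = 0" using mixed by (simp_all add: inner_commute)
    qed
    have "{p, q} \<noteq> UNIV"
    proof
      assume "{p, q} = UNIV"
      then have "card {p, q} \<ge> 3" using card by simp
      then show False using pq by simp
    qed
    then obtain r where r: "r \<notin> {p, q}" by blast
    obtain M where M: "rotation_matrix M" "\<And>j. j \<in> {p, q} \<Longrightarrow> M$j = (if j = p then x else y)"
      using rotation_rows_extend[of "{p, q}" "\<lambda>j. if j = p then x else y", OF _ r]
      using xx yy xy pq by (smt (verit) insertE singletonD)
    have rows: "M$p = x" "M$q = y" using M(2) pq by auto
    have "(M$p$i)\<^sup>2 + (M$q$i)\<^sup>2 = 2 / real CARD('k)" for i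
    proof -
      have "(M$p$i)\<^sup>2 + (M$q$i)\<^sup>2 = ((Re (z$i))\<^sup>2 + (Im (z$i))\<^sup>2) / c\<^sup>2"
        by (simp add: rows x_def y_def power_divide add_divide_distrib)
      then show ?thesis by (simp add: norms c)
    qed
    then have "M \<in> rotations_with_balanced_rows p q"
      using M(1) by (simp add: rotations_with_balanced_rows_def)
    moreover have "z = row_pair p q M"
      using c by (simp add: row_pair_def vec_eq_iff complex_eq_iff rows x_def y_def flip: c_def)
    ultimately show "z \<in> row_pair p q ` rotations_with_balanced_rows p q" by blast
  }
qed

text \<open>Between compact spaces, a continuous surjection with connected fibres onto a connected space
  has a connected domain.\<close>

lemma connected_rotations_with_balanced_rows:
  assumes card: "CARD('k) \<ge> 4" and pq: "p \<noteq> q"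
  shows "connected (rotations_with_balanced_rows p q :: (real^'k^'k) set)"
proof -
  let ?S = "rotations_with_balanced_rows p q :: (real^'k^'k) set"
  have cont: "continuous_on ?S (row_pair p q)"
    unfolding row_pair_def Complex_eq by (intro continuous_intros)
  have image: "row_pair p q ` ?S = polygon_lifts"
    using card pq by (intro row_pair_image) auto
  have fibre: "connected (?S \<inter> row_pair p q -` {z})" for z
    unfolding connected_iff_connected_component
  proof (intro ballI)
    fix M M' assume M: "M \<in> ?S \<inter> row_pair p q -` {z}" and M': "M' \<in> ?S \<inter> row_pair p q -` {z}"
    have "M'$j$i = M$j$i" if "j \<in> {p, q}" for j i
    proof -
      have "row_pair p q M' $ i = row_pair p q M $ i" using M M' by simp
      then show ?thesis using that by (auto simp: row_pair_def complex_eq_iff)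
    qed
    then have "M'$j = M$j" if "j \<in> {p, q}" for j
      using that by (simp add: vec_eq_iff)
    then have "connected_component {A. rotation_matrix A \<and> (\<forall>j\<in>{p, q}. A$j = M$j)} M M'"
      using M M' unfolding rotations_with_balanced_rows_def
      by (intro connected_component_rotations_fixing_rows) auto
    then show "connected_component (?S \<inter> row_pair p q -` {z}) M M'"
    proof (rule connected_component_of_subset)
      show "{A. rotation_matrix A \<and> (\<forall>j\<in>{p, q}. A$j = M$j)} \<subseteq> ?S \<inter> row_pair p q -` {z}"
        using M by (auto simp: rotations_with_balanced_rows_def row_pair_def)
    qed
  qed
  have "connected (?S \<inter> row_pair p q -` polygon_lifts)"
  proof (rule connected_closed_monotone_preimage[OF cont image _ fibre connected_polygon_lifts[OF card]])
    show "closedin (top_of_set polygon_lifts) (row_pair p q ` C)"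
      if "closedin (top_of_set ?S) C" for C
    proof (rule closed_subset)
      have C: "C \<subseteq> ?S" using that by (rule closedin_imp_subset)
      then show "row_pair p q ` C \<subseteq> polygon_lifts" using image by blast
      have "compact C"
        using compact_rotations_with_balanced_rows that by (rule closedin_compact)
      then show "closed (row_pair p q ` C)"
        by (intro compact_imp_closed compact_continuous_image continuous_on_subset[OF cont C])
    qed
  qed auto
  moreover have "?S \<inter> row_pair p q -` polygon_lifts = ?S"
    using image by blast
  ultimately show ?thesis by simp
qed

text \<open>The frame whose \<open>a\<close>-th components are the entries of the row \<open>\<iota> a\<close> of \<open>M\<close>, scaled by the square
  root of the frame bound \<open>k / n\<close>.\<close>

definition frame_of_rows :: "('n \<Rightarrow> 'k) \<Rightarrow> real^'k^'k \<Rightarrow> real^'n^'k" where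
  "frame_of_rows \<iota> M = (\<chi> i. \<chi> a. sqrt (real CARD('k) / real CARD('n)) * M$(\<iota> a)$i)"

lemma orthogonal_matrix_sum_column_squares:
  fixes M :: "real^'k^'k" and \<iota> :: "'n::finite \<Rightarrow> 'k"
  assumes M: "orthogonal_matrix M" and \<iota>: "bij_betw \<iota> UNIV (- {p, q})" and pq: "p \<noteq> q"
  shows "(\<Sum>a\<in>UNIV. (M$(\<iota> a)$i)\<^sup>2) + ((M$p$i)\<^sup>2 + (M$q$i)\<^sup>2) = 1"
proof -
  have "column i M \<bullet> column i M = 1"
    using M by (simp add: orthogonal_matrix_orthonormal_columns norm_eq_1)
  then have "(\<Sum>j\<in>UNIV. (M$j$i)\<^sup>2) = 1"
    by (simp add: inner_vec_def column_def power2_eq_square)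
  moreover have "(\<Sum>j\<in>UNIV. (M$j$i)\<^sup>2) = (\<Sum>j\<in>- {p, q}. (M$j$i)\<^sup>2) + (\<Sum>j\<in>{p, q}. (M$j$i)\<^sup>2)"
    using sum.subset_diff[of "{p, q}" UNIV "\<lambda>j. (M$j$i)\<^sup>2"] by (simp add: Compl_eq_Diff_UNIV)
  moreover have "(\<Sum>a\<in>UNIV. (M$(\<iota> a)$i)\<^sup>2) = (\<Sum>j\<in>- {p, q}. (M$j$i)\<^sup>2)"
    by (rule sum.reindex_bij_betw[OF \<iota>])
  ultimately show ?thesis using pq by simp
qed

lemma frame_of_rows_tight:
  fixes M :: "real^'k^'k" and \<iota> :: "'n::finite \<Rightarrow> 'k"
  assumes card: "CARD('k) = CARD('n) + 2" and \<iota>: "bij_betw \<iota> UNIV (- {p, q})" and pq: "p \<noteq> q"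
    and M: "M \<in> rotations_with_balanced_rows p q"
  shows "frame_of_rows \<iota> M \<in> spherical_tight_frames"
proof -
  let ?B = "real CARD('k) / real CARD('n)"
  have B: "?B > 0" by simp
  have orth: "orthogonal_matrix M" and bal: "\<And>i. (M$p$i)\<^sup>2 + (M$q$i)\<^sup>2 = 2 / real CARD('k)"
    using M by (simp_all add: rotations_with_balanced_rows_def rotation_matrix_def)
  have "norm (frame_of_rows \<iota> M $ i) = 1" for i
  proof (rule norm_eq_1_if_power2)
    have "(norm (frame_of_rows \<iota> M $ i))\<^sup>2 = (\<Sum>a\<in>UNIV. (sqrt ?B * M$(\<iota> a)$i)\<^sup>2)"
      unfolding power2_norm_eq_inner by (simp add: inner_vec_def frame_of_rows_def power2_eq_square)
    also have "\<dots> = ?B * (\<Sum>a\<in>UNIV. (M$(\<iota> a)$i)\<^sup>2)"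
      using B by (simp only: power_mult_distrib real_sqrt_pow2 less_imp_le sum_distrib_left)
    also have "(\<Sum>a\<in>UNIV. (M$(\<iota> a)$i)\<^sup>2) = 1 - 2 / real CARD('k)"
      using orthogonal_matrix_sum_column_squares[OF orth \<iota> pq, of i] bal[of i] by linarith
    also have "?B * \<dots> = real CARD('k) / real CARD('n) - 2 / real CARD('n)"
      by (simp add: right_diff_distrib)
    also have "\<dots> = 1"
      by (simp add: card add_divide_distrib)
    finally show "(norm (frame_of_rows \<iota> M $ i))\<^sup>2 = 1" .
  qed
  moreover have "(\<Sum>i\<in>UNIV. \<bar>v \<bullet> frame_of_rows \<iota> M $ i\<bar>\<^sup>2) = ?B * (norm v)\<^sup>2" for v
  proof -
    define u where "u = (\<Sum>a\<in>UNIV. v$a *\<^sub>R M$(\<iota> a))"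
    have inner: "M$(\<iota> a) \<bullet> M$(\<iota> b) = (if a = b then 1 else 0)" for a b
      using orth bij_betw_imp_inj_on[OF \<iota>]
      by (simp add: orthogonal_matrix_iff_inner_rows inj_eq)
    have uu: "u \<bullet> u = v \<bullet> v"
      by (simp add: u_def inner_sum_left inner_sum_right inner inner_vec_def[of v v]
          if_distrib[of "\<lambda>x. _ * x"] cong: if_cong)
    have "v \<bullet> frame_of_rows \<iota> M $ i = sqrt ?B * u$i" for i
      by (simp add: u_def frame_of_rows_def inner_vec_def sum_distrib_left mult.left_commute)
    then have "(\<Sum>i\<in>UNIV. \<bar>v \<bullet> frame_of_rows \<iota> M $ i\<bar>\<^sup>2) = (\<Sum>i\<in>UNIV. ?B * (u$i)\<^sup>2)"
      using B by (simp only: power2_abs power_mult_distrib real_sqrt_pow2 less_imp_le)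
    also have "\<dots> = ?B * (u \<bullet> u)"
      by (simp only: sum_distrib_left inner_vec_def power2_eq_square inner_real_def)
    finally show ?thesis by (simp add: uu power2_norm_eq_inner)
  qed
  ultimately show ?thesis
    unfolding spherical_tight_frames_def using B by blast
qed

text \<open>The rows of component vectors of a tight frame are orthogonal of squared length \<open>B\<close>; counting the
  squares of all components in two ways gives the value of \<open>B\<close>.\<close>

lemma tight_frame_component_rows:
  fixes f :: "real^'n^'k"
  assumes unit: "\<And>i. norm (f$i) = 1"
    and tight: "\<And>v. (\<Sum>i\<in>UNIV. \<bar>v \<bullet> f$i\<bar>\<^sup>2) = B * (norm v)\<^sup>2"
  shows "(\<Sum>i\<in>UNIV. f$i$a * f$i$b) = (if a = b then B else 0)"
    and "B = real CARD('k) / real CARD('n)"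
proof -
  have diag: "(\<Sum>i\<in>UNIV. f$i$a * f$i$a) = B" for a
    using tight[of "axis a 1"] by (simp add: inner_axis' power2_eq_square)
  show "(\<Sum>i\<in>UNIV. f$i$a * f$i$b) = (if a = b then B else 0)"
  proof (cases "a = b")
    case False
    have "(norm (axis a 1 + axis b 1 :: real^'n))\<^sup>2 = 2"
      using False by (simp add: power2_norm_eq_inner inner_add_left inner_add_right inner_axis_axis)
    then have "(\<Sum>i\<in>UNIV. (f$i$a + f$i$b)\<^sup>2) = B * 2"
      using tight[of "axis a 1 + axis b 1"] by (simp add: inner_add_left inner_axis')
    moreover have "(\<Sum>i\<in>UNIV. (f$i$a + f$i$b)\<^sup>2) =
        (\<Sum>i\<in>UNIV. f$i$a * f$i$a) + (\<Sum>i\<in>UNIV. f$i$b * f$i$b) + 2 * (\<Sum>i\<in>UNIV. f$i$a * f$i$b)"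
      by (simp add: power2_eq_square algebra_simps sum.distrib sum_distrib_left)
    ultimately show ?thesis using False diag by simp
  qed (simp add: diag)
  have "B * real CARD('n) = (\<Sum>a\<in>UNIV. \<Sum>i\<in>UNIV. f$i$a * f$i$a)"
    by (simp add: diag)
  also have "\<dots> = (\<Sum>i\<in>UNIV. f$i \<bullet> f$i)"
    by (subst sum.swap) (simp add: inner_vec_def)
  also have "\<dots> = real CARD('k)"
    using unit by (simp add: norm_eq_1)
  finally show "B = real CARD('k) / real CARD('n)"
    by (simp add: field_simps)
qed

lemma spherical_tight_frames_eq_image:
  fixes \<iota> :: "'n::finite \<Rightarrow> 'k::finite"
  assumes card: "CARD('k) = CARD('n) + 2" and \<iota>: "bij_betw \<iota> UNIV (- {p, q})" and pq: "p \<noteq> q"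
  shows "spherical_tight_frames = frame_of_rows \<iota> ` rotations_with_balanced_rows p q"
proof (intro equalityI subsetI)
  fix f :: "real^'n^'k" assume "f \<in> spherical_tight_frames"
  then obtain B where unit: "\<And>i. norm (f$i) = 1" and B0: "B > 0"
    and tight: "\<And>v. (\<Sum>i\<in>UNIV. \<bar>v \<bullet> f$i\<bar>\<^sup>2) = B * (norm v)\<^sup>2"
    by (auto simp: spherical_tight_frames_def)
  note rows = tight_frame_component_rows[OF unit tight]
  define w where "w j = (\<chi> i. f$i$(inv \<iota> j) / sqrt B)" for j
  have inj: "inj \<iota>" using \<iota> by (rule bij_betw_imp_inj_on)
  have w: "w (\<iota> a) = (\<chi> i. f$i$a / sqrt B)" for a
    by (simp add: w_def inv_f_f[OF inj])
  have range: "- {p, q} = range \<iota>"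
    using \<iota> by (simp add: bij_betw_def)
  have "w i \<bullet> w j = (if i = j then 1 else 0)" if ij: "i \<in> - {p, q}" "j \<in> - {p, q}" for i j
  proof -
    obtain a b where ab: "i = \<iota> a" "j = \<iota> b" using ij unfolding range by blast
    have "w (\<iota> a) \<bullet> w (\<iota> b) = (\<Sum>i\<in>UNIV. f$i$a * f$i$b) / B"
      using B0 by (simp add: w inner_vec_def sum_divide_distrib)
    then show ?thesis
      using B0 by (simp add: ab rows(1) inj_eq[OF inj])
  qed
  then obtain M where M: "rotation_matrix M" "\<And>j. j \<in> - {p, q} \<Longrightarrow> M$j = w j"
    using rotation_rows_extend[of "- {p, q}" w p] by blast
  have M\<iota>: "M$(\<iota> a)$i = f$i$a / sqrt B" for a i
    using M(2)[of "\<iota> a"] unfolding range by (simp add: w)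
  have "(M$p$i)\<^sup>2 + (M$q$i)\<^sup>2 = 2 / real CARD('k)" for i
  proof -
    have "(\<Sum>a\<in>UNIV. (M$(\<iota> a)$i)\<^sup>2) = (f$i \<bullet> f$i) / B"
      using B0 by (simp add: M\<iota> inner_vec_def power_divide sum_divide_distrib power2_eq_square[of "_ $ _"])
    also have "\<dots> = real CARD('n) / real CARD('k)"
      using unit by (simp add: rows(2) norm_eq_1)
    also have "\<dots> = 1 - 2 / real CARD('k)"
      by (simp add: card field_simps)
    finally show ?thesis
      using orthogonal_matrix_sum_column_squares[OF _ \<iota> pq, of M i] M(1)
      by (simp add: rotation_matrix_def)
  qed
  then have "M \<in> rotations_with_balanced_rows p q"
    using M(1) by (simp add: rotations_with_balanced_rows_def)
  moreover have "f = frame_of_rows \<iota> M"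
    using B0 unfolding frame_of_rows_def rows(2)[symmetric] by (simp add: M\<iota> vec_eq_iff)
  ultimately show "f \<in> frame_of_rows \<iota> ` rotations_with_balanced_rows p q" by blast
qed (use frame_of_rows_tight[OF assms] in blast)

theorem corollary7p5:
  assumes "CARD('n::finite) \<ge> 2"
    and "CARD('k::finite) = CARD('n) + 2"
  shows "connected (spherical_tight_frames :: (real ^ 'n ^ 'k) set)"
proof -
  have card: "CARD('k) \<ge> 4" using assms by simp
  have "2 \<le> card (UNIV :: 'k set)" using card by simp
  then obtain X :: "'k set" where "card X = 2"
    using obtain_subset_with_card_n by metis
  then obtain p q :: 'k where pq: "p \<noteq> q" by (auto simp: card_2_iff)
  have "card (UNIV :: 'n set) = card (- {p, q})"
    using assms(2) pq by (simp add: Compl_eq_Diff_UNIV card_Diff_subset)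
  then obtain \<iota> :: "'n \<Rightarrow> 'k" where \<iota>: "bij_betw \<iota> UNIV (- {p, q})"
    using finite_same_card_bij by (metis finite)
  have "continuous_on (rotations_with_balanced_rows p q) (frame_of_rows \<iota>)"
    unfolding frame_of_rows_def by (intro continuous_intros)
  then show ?thesis
    unfolding spherical_tight_frames_eq_image[OF assms(2) \<iota> pq]
    using connected_rotations_with_balanced_rows[OF card pq] by (rule connected_continuous_image)
qed

end
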